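(* Let $p$ be a prime, let $f(x,y)\in Z_p[x,y]$ be a homogeneous polynomial of degree $n\ge 1$, and let $K=Z_p\langle a,b\mid f(a,b)=0\rangle$ be the two-generated commutative ring of characteristic $p$ defined by the single relation $f(a,b)=0$. Then $K$ is finitely separable if and only if $f(x,y)$ is separable, i.e. $f(x,y)$ is a product of pairwise distinct (pairwise non-associate) irreducible polynomials in $Z_p[x,y]$.
   Context: Rings are associative and are not required to have an identity; subrings and homomorphisms are in the sense of rings not necessarily with identity. $Z_p$ is the field of residues modulo the prime $p$. A polynomial is homogeneous if all its monomials have the same total degree. The ring $Z_p\langle a,b\mid f(a,b)=0\rangle$ is the quotient $Z_p^*[x,y]/I(f)$, where $Z_p^*[x,y]$ is the (non-unital) ring of polynomials in $Z_p[x,y]$ with zero constant term, $I(f)$ is the principal ideal of $Z_p[x,y]$ generated by $f$, and $a,b$ are the images of $x,y$. A ring $K$ is finitely separable if for every $c\in K$ and every subring $A'\subseteq K$ with $c\notin A'$ there exist a finite ring $F$ and a ring homomorphism $\varphi:K\to F$ with $\varphi(c)\notin\varphi(A')$. *)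

theory Defs
  imports
    "HOL-Algebra.QuotRing"
    "Berlekamp_Zassenhaus.Finite_Field"
begin

section \<open>Rings not necessarily with identity\<close>

text \<open>Associative rings without identity are represented by the \<open>HOL-Algebra\<close> ring records.
  The field \<^const>\<open>one\<close> of such a record plays no role, and the library notions that
  refer to it (\<^locale>\<open>ring\<close>, \<open>subring\<close>, \<^const>\<open>ring_hom\<close>) are replaced by the following ones.\<close>

locale nonunital_ring = abelian_group R for R (structure) +
  assumes m_closed: "\<lbrakk>x \<in> carrier R; y \<in> carrier R\<rbrakk> \<Longrightarrow> x \<otimes> y \<in> carrier R"
    and m_assoc: "\<lbrakk>x \<in> carrier R; y \<in> carrier R; z \<in> carrier R\<rbrakk>
      \<Longrightarrow> (x \<otimes> y) \<otimes> z = x \<otimes> (y \<otimes> z)"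
    and l_distr: "\<lbrakk>x \<in> carrier R; y \<in> carrier R; z \<in> carrier R\<rbrakk>
      \<Longrightarrow> (x \<oplus> y) \<otimes> z = x \<otimes> z \<oplus> y \<otimes> z"
    and r_distr: "\<lbrakk>x \<in> carrier R; y \<in> carrier R; z \<in> carrier R\<rbrakk>
      \<Longrightarrow> z \<otimes> (x \<oplus> y) = z \<otimes> x \<oplus> z \<otimes> y"

definition nonunital_subring :: "'a set \<Rightarrow> ('a, 'm) ring_scheme \<Rightarrow> bool" where
  "nonunital_subring A R \<longleftrightarrow>
     additive_subgroup A R \<and> (\<forall>x\<in>A. \<forall>y\<in>A. x \<otimes>\<^bsub>R\<^esub> y \<in> A)"

definition nonunital_ring_hom ::
  "('a, 'm) ring_scheme \<Rightarrow> ('b, 'n) ring_scheme \<Rightarrow> ('a \<Rightarrow> 'b) set" where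
  "nonunital_ring_hom R S = hom R S \<inter> hom (add_monoid R) (add_monoid S)"

text \<open>HOL cannot quantify over the type of the elements of \<open>F\<close>. Carriers that are sets of natural
  numbers suffice, since every finite ring is isomorphic to one of that form.\<close>

definition finitely_separable :: "('a, 'm) ring_scheme \<Rightarrow> bool" where
  "finitely_separable K \<longleftrightarrow>
     (\<forall>c \<in> carrier K. \<forall>A. nonunital_subring A K \<and> c \<notin> A \<longrightarrow>
        (\<exists>(F :: nat ring) \<phi>. nonunital_ring F \<and> finite (carrier F) \<and>
           \<phi> \<in> nonunital_ring_hom K F \<and> \<phi> c \<notin> \<phi> ` A))"


section \<open>Polynomials in two variables\<close>

text \<open>\<open>R[x,y]\<close> is rendered as \<open>(R[x])[y]\<close>, i.e.\ as the type \<open>'a poly poly\<close>, so that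
  \<open>coeff (coeff f j) i\<close> is the coefficient of \<open>x\<^sup>i y\<^sup>j\<close>. With \<open>R = 'p mod_ring\<close>, where the type
  variable \<open>'p::prime_card\<close> stands for an arbitrary prime \<open>p = CARD('p)\<close>, this is
  \<open>Z\<^sub>p[x,y]\<close>. The zero polynomial has no degree and is
  therefore not homogeneous of degree \<open>n\<close>.\<close>

definition homogeneous_of_degree :: "nat \<Rightarrow> 'a::zero poly poly \<Rightarrow> bool" where
  "homogeneous_of_degree n f \<longleftrightarrow>
     f \<noteq> 0 \<and> (\<forall>i j. Polynomial.coeff (Polynomial.coeff f j) i \<noteq> 0 \<longrightarrow> i + j = n)"

text \<open>A unit factor need not be mentioned: it can be absorbed into one of the irreducible factors,
  of which there is at least one if \<open>f\<close> is not constant.\<close>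

definition separable_poly :: "'a::idom poly poly \<Rightarrow> bool" where
  "separable_poly f \<longleftrightarrow>
     (\<exists>S. finite S \<and> (\<forall>g\<in>S. Factorial_Ring.irreducible g) \<and>
        pairwise (\<lambda>g h. \<not> (g dvd h \<and> h dvd g)) S \<and> f = \<Prod>S)"

definition zero_const_poly_ring :: "'a::comm_ring_1 poly poly ring" where
  "zero_const_poly_ring =
     \<lparr>carrier = {g. Polynomial.coeff (Polynomial.coeff g 0) 0 = 0},
      monoid.mult = (*), one = undefined, zero = 0, add = (+)\<rparr>"

definition two_generated_ring :: "'a::comm_ring_1 poly poly \<Rightarrow> 'a poly poly set ring" where
  "two_generated_ring f = zero_const_poly_ring Quot (range (\<lambda>g. f * g))"

text \<open>If \<open>f\<close> itself has zero constant term, the quotient is indeed a ring.\<close>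

lemma nonunital_ring_two_generated_ring:
  fixes f :: "'a::comm_ring_1 poly poly"
  assumes "Polynomial.coeff (Polynomial.coeff f 0) 0 = 0"
  shows "nonunital_ring (two_generated_ring f)"
proof -
  let ?R = "zero_const_poly_ring :: 'a poly poly ring"
  let ?I = "range (\<lambda>g. f * g)"
  have R: "abelian_group ?R"
  proof (rule abelian_groupI)
    fix x assume "x \<in> carrier ?R"
    then show "\<exists>y\<in>carrier ?R. y \<oplus>\<^bsub>?R\<^esub> x = \<zero>\<^bsub>?R\<^esub>"
      by (intro bexI[of _ "- x"]) (auto simp: zero_const_poly_ring_def)
  qed (auto simp: zero_const_poly_ring_def)
  interpret R: abelian_group ?R by (rule R)
  have ainv: "\<ominus>\<^bsub>?R\<^esub> x = - x" if "x \<in> carrier ?R" for x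
    by (rule R.minus_equality) (use that in \<open>auto simp: zero_const_poly_ring_def\<close>)
  have sub: "?I \<subseteq> carrier ?R"
    using assms by (auto simp: zero_const_poly_ring_def coeff_mult)
  have "subgroup ?I (add_monoid ?R)"
  proof (rule R.a_group[THEN group.subgroupI])
    show "inv\<^bsub>add_monoid ?R\<^esub> x \<in> ?I" if "x \<in> ?I" for x
    proof -
      have "inv\<^bsub>add_monoid ?R\<^esub> x = - x" using ainv that sub unfolding a_inv_def by blast
      with that show ?thesis by (auto intro: range_eqI[of _ _ "- _"])
    qed
    show "x \<otimes>\<^bsub>add_monoid ?R\<^esub> y \<in> ?I" if "x \<in> ?I" "y \<in> ?I" for x y
      using that by (auto simp: zero_const_poly_ring_def simp flip: distrib_left)
  qed (use sub in auto)
  then interpret I: abelian_subgroup ?I ?R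
    by (intro abelian_subgroupI3 additive_subgroup.intro R)
  have coset: "?I +>\<^bsub>?R\<^esub> x = {y. f dvd y - x}" for x
    by (auto simp: a_r_coset_def' zero_const_poly_ring_def dvd_def) (metis diff_add_cancel)
  have mult: "rcoset_mult ?R ?I (?I +>\<^bsub>?R\<^esub> x) (?I +>\<^bsub>?R\<^esub> y) = ?I +>\<^bsub>?R\<^esub> (x * y)" for x y
  proof -
    have m: "f dvd z - x * y" if "f dvd u - x" "f dvd v - y" "f dvd z - u * v" for u v z
    proof -
      have "z - x * y = (z - u * v) + (u - x) * v + x * (v - y)" by (simp add: algebra_simps)
      then show ?thesis using that by (metis dvd_add dvd_mult dvd_mult2)
    qed
    have "monoid.mult ?R = (*)" by (simp add: zero_const_poly_ring_def)
    then show ?thesis unfolding rcoset_mult_def coset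
      by (auto intro: m bexI)
        (metis diff_self dvd_0_right)
  qed
  have add: "(?I +>\<^bsub>?R\<^esub> x) <+>\<^bsub>?R\<^esub> (?I +>\<^bsub>?R\<^esub> y) = ?I +>\<^bsub>?R\<^esub> (x + y)"
    if "x \<in> carrier ?R" "y \<in> carrier ?R" for x y
    using I.a_rcos_sum[OF that] by (simp add: zero_const_poly_ring_def)
  have clos: "x + y \<in> carrier ?R" "x * y \<in> carrier ?R"
    if "x \<in> carrier ?R" "y \<in> carrier ?R" for x y
    using that by (auto simp: zero_const_poly_ring_def coeff_mult)
  show ?thesis
    unfolding two_generated_ring_def
  proof (intro nonunital_ring.intro nonunital_ring_axioms.intro)
    show "abelian_group (?R Quot ?I)"
      using I.a_factorgroup_is_comm_group[unfolded A_FactGroup_def']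
      by (intro abelian_group.intro abelian_monoid.intro abelian_group_axioms.intro)
         (simp_all add: FactRing_def comm_group_def)
  qed (auto simp: FactRing_def A_RCOSETS_def' mult add clos distrib_left distrib_right mult.assoc)
qed

end

theory Submission
  imports Defs
begin

text \<open>Let \<open>R = Z\<^sub>p[x,y]\<close> and let \<open>m\<close> be its ideal of polynomials without constant term.

  If \<open>f = g\<^sup>2 h\<close> with \<open>g\<close> not a unit, then \<open>c = g h\<close> has square zero in \<open>K\<close>, so \<open>c V\<close> is a subring
  for every additive subgroup \<open>V\<close> of \<open>R\<close>. Choose \<open>t \<in> {x, y}\<close> transcendental modulo \<open>g\<close> and let \<open>V\<close> consist of
  the \<open>g r + q(t)\<close> on whose \<open>q\<close> the functional \<open>t\<^sup>k \<mapsto> s\<^sub>k\<close> vanishes, where \<open>s\<close> is the indicator of \<open>0\<close>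
  and the powers of two. A finite image identifies some \<open>c t\<^sup>i\<close> and \<open>c t\<^sup>j\<close>, hence all their shifts,
  and since \<open>s\<close> is not eventually periodic the image of \<open>c\<close> lies in that of \<open>c V\<close>, although
  \<open>c \<notin> c V\<close>.

  Conversely let \<open>f = g\<^sub>1 \<cdots> g\<^sub>r\<close> be squarefree; the \<open>g\<^sub>i\<close> are forms. If \<open>w \<in> m\<close> is divisible by no
  \<open>g\<^sub>i\<close>, then \<open>R/f\<close> is a finitely generated \<open>Z\<^sub>p[w]\<close>-module, so each of its submodules is an
  intersection of submodules of finite index of the form \<open>A + h(w) R\<close>. A subring \<open>A\<close> contains some \<open>w\<close>
  outside all \<open>g\<^sub>i R\<close> with \<open>A \<not>\<subseteq> g\<^sub>i R\<close>. With \<open>P\<close> the product of these \<open>g\<^sub>i\<close> and \<open>Q\<close> that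
  of the others, \<open>A + P R\<close> is a module over \<open>Z\<^sub>p[w + P]\<close>, and \<open>w + P\<close> is divisible by no \<open>g\<^sub>i\<close>. This separates
  \<open>c\<close> from \<open>A\<close> unless \<open>c \<in> A + P R\<close>; in that case \<open>c\<close> is separated from \<open>A \<subseteq> Q R\<close> by an ideal that separates
  the \<open>P R\<close>-component of \<open>c\<close> from \<open>Q R\<close>.\<close>

section \<open>Substitution of a bivariate polynomial into univariate ones\<close>

hide_const (open) UnivPoly.coeff UnivPoly.monom Module.smult

abbreviation const :: "'a::zero \<Rightarrow> 'a poly poly" where
  "const c \<equiv> [:[:c:]:]"

abbreviation zero_const_term :: "'a::zero poly poly \<Rightarrow> bool" where
  "zero_const_term u \<equiv> coeff (coeff u 0) 0 = 0"

text \<open>The substitution \<open>s(X) \<mapsto> s(w)\<close>. It makes the bivariate polynomials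
  a module over the univariate ones, with \<open>X\<close> acting as multiplication by
  \<open>w\<close>.\<close>

definition eval_at :: "'a::comm_ring_1 poly poly \<Rightarrow> 'a poly \<Rightarrow> 'a poly poly" where
  "eval_at w s = poly (map_poly const s) w"

lemma eval_at_0 [simp]: "eval_at w 0 = 0"
  and eval_at_pCons: "eval_at w (pCons c s) = const c + w * eval_at w s"
proof -
  show "eval_at w 0 = 0" by (simp add: eval_at_def)
  show "eval_at w (pCons c s) = const c + w * eval_at w s"
    by (cases "c = 0 \<and> s = 0") (auto simp: eval_at_def map_poly_pCons)
qed

lemma eval_at_add: "eval_at w (s + t) = eval_at w s + eval_at w t"
  by (induction s t rule: poly_induct2) (simp_all add: eval_at_pCons distrib_left)

lemma eval_at_smult: "eval_at w (Polynomial.smult c s) = const c * eval_at w s"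
  by (induction s) (simp_all add: eval_at_pCons algebra_simps)

lemma eval_at_mult: "eval_at w (s * t) = eval_at w s * eval_at w t"
  by (induction s) (simp_all add: eval_at_pCons eval_at_add eval_at_smult algebra_simps)

lemma eval_at_minus: "eval_at w (- s) = - eval_at w s"
  using eval_at_add[of w s "- s"] by (simp add: add_eq_0_iff)

lemma eval_at_diff: "eval_at w (s - t) = eval_at w s - eval_at w t"
  using eval_at_add[of w s "- t"] by (simp add: eval_at_minus)

lemma eval_at_1 [simp]: "eval_at w 1 = 1"
  by (simp add: one_pCons eval_at_pCons)

lemma eval_at_X: "eval_at w [:0, 1:] = w"
  by (simp add: eval_at_pCons flip: one_pCons)

subsection \<open>Submodules over the subring generated by one element\<close>

text \<open>Asking only for closure under scalars and \<open>w\<close> keeps the conditions easy to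
  verify; closure under every \<open>eval_at w s\<close> follows by induction on
  \<open>s\<close>.\<close>

definition submodule_over :: "'a::comm_ring_1 poly poly \<Rightarrow> 'a poly poly set \<Rightarrow> bool" where
  "submodule_over w A \<longleftrightarrow> 0 \<in> A \<and> (\<forall>u\<in>A. \<forall>v\<in>A. u + v \<in> A) \<and>
     (\<forall>c. \<forall>u\<in>A. const c * u \<in> A) \<and> (\<forall>u\<in>A. w * u \<in> A)"

lemma submodule_overI:
  assumes "0 \<in> A" "\<And>u v. u \<in> A \<Longrightarrow> v \<in> A \<Longrightarrow> u + v \<in> A"
    "\<And>c u. u \<in> A \<Longrightarrow> const c * u \<in> A" "\<And>u. u \<in> A \<Longrightarrow> w * u \<in> A"
  shows "submodule_over w A"
  using assms unfolding submodule_over_def by blast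

context
  fixes w :: "'a::comm_ring_1 poly poly" and A
  assumes A: "submodule_over w A"
begin

lemma submodule_over_zero: "0 \<in> A"
  and submodule_over_add: "u \<in> A \<Longrightarrow> v \<in> A \<Longrightarrow> u + v \<in> A"
  and submodule_over_const_mult: "u \<in> A \<Longrightarrow> const c * u \<in> A"
  and submodule_over_mult: "u \<in> A \<Longrightarrow> w * u \<in> A"
  using A unfolding submodule_over_def by blast+

lemma submodule_over_uminus: "u \<in> A \<Longrightarrow> - u \<in> A"
proof -
  assume "u \<in> A"
  moreover have "const (- 1) = (- 1 :: 'a poly poly)" by (simp add: one_pCons)
  ultimately show "- u \<in> A" using submodule_over_const_mult[of u "- 1"] by simp
qed

lemma submodule_over_diff: "u \<in> A \<Longrightarrow> v \<in> A \<Longrightarrow> u - v \<in> A"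
  using submodule_over_add[of u "- v"] submodule_over_uminus by simp

lemma submodule_over_eval_at: "u \<in> A \<Longrightarrow> eval_at w s * u \<in> A"
  by (induction s)
     (auto simp: eval_at_pCons distrib_right mult.assoc submodule_over_zero
        simp del: mult_pCons_left intro!: submodule_over_add submodule_over_mult submodule_over_const_mult)

end

text \<open>Peeling off one generator at a time gives access to the coefficient of the first one, on
  which the separation argument rests.\<close>

fun span_over :: "'a::comm_ring_1 poly poly \<Rightarrow> 'a poly poly list \<Rightarrow> 'a poly poly set" where
  "span_over w [] = {0}"
| "span_over w (b # bs) = {eval_at w s * b + m | s m. m \<in> span_over w bs}"

lemma submodule_over_span: "submodule_over w (span_over w bs)"
proof (induction bs)
  case Nil
  then show ?case by (auto simp: submodule_over_def)
next
  case (Cons b bs)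
  note IH = Cons.IH
  show ?case
  proof (rule submodule_overI)
    show "0 \<in> span_over w (b # bs)"
      using submodule_over_zero[OF IH] by (auto intro!: exI[of _ 0])
  next
    fix u v assume "u \<in> span_over w (b # bs)" "v \<in> span_over w (b # bs)"
    then obtain s m s' m' where "u = eval_at w s * b + m" "v = eval_at w s' * b + m'"
      "m \<in> span_over w bs" "m' \<in> span_over w bs" by auto
    then show "u + v \<in> span_over w (b # bs)" using submodule_over_add[OF IH]
      by (auto intro!: exI[of _ "s + s'"] exI[of _ "m + m'"] simp: eval_at_add algebra_simps)
  next
    fix u c assume "u \<in> span_over w (b # bs)"
    then obtain s m where "u = eval_at w s * b + m" "m \<in> span_over w bs" by auto
    then show "const c * u \<in> span_over w (b # bs)"
      using submodule_over_const_mult[OF IH, of m c]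
      by (auto intro!: exI[of _ "Polynomial.smult c s"] exI[of _ "const c * m"]
          simp: eval_at_smult smult_add_right)
  next
    fix u assume "u \<in> span_over w (b # bs)"
    then obtain s m where "u = eval_at w s * b + m" "m \<in> span_over w bs" by auto
    then show "w * u \<in> span_over w (b # bs)"
      using submodule_over_mult[OF IH, of m]
      by (auto intro!: exI[of _ "pCons 0 s"] exI[of _ "w * m"]
          simp: eval_at_pCons algebra_simps)
  qed
qed

lemma set_subset_span_over: "set bs \<subseteq> span_over w bs"
proof (induction bs)
  case (Cons b bs)
  have "b = eval_at w 1 * b + 0" "0 \<in> span_over w bs"
    using submodule_over_zero[OF submodule_over_span] by auto
  moreover have "m \<in> span_over w (b # bs)" if "m \<in> span_over w bs" for m
    using that by (auto intro!: exI[of _ 0] exI[of _ m])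
  ultimately have "b \<in> span_over w (b # bs)" "span_over w bs \<subseteq> span_over w (b # bs)"
    unfolding span_over.simps(2) by blast+
  then show ?case using Cons by auto
qed simp

text \<open>Induction on the generators. The coefficients of \<open>b\<close> that occur in
  \<open>A\<close> form an ideal \<open>I\<close> of univariate polynomials. Either the coefficient
  of \<open>c\<close> lies outside \<open>I\<close>, and \<open>h\<close> is chosen to keep it
  there, or it can be cancelled modulo \<open>A\<close>, which leaves a problem about
  \<open>bs\<close>.\<close>

lemma separate_in_span_over:
  fixes w :: "'a::field poly poly"
  assumes A: "submodule_over w A"
  shows "c \<in> span_over w bs \<Longrightarrow> c \<notin> A \<Longrightarrow>
    \<exists>h. h \<noteq> 0 \<and> (\<forall>m\<in>span_over w bs. c - eval_at w h * m \<notin> A)"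
proof (induction bs arbitrary: c)
  case Nil
  then show ?case using submodule_over_zero[OF A] by auto
next
  case (Cons b bs)
  note A_add = submodule_over_add[OF A] and A_diff = submodule_over_diff[OF A]
    and A_ev = submodule_over_eval_at[OF A]
  note M = submodule_over_span[of w bs]
  note M_add = submodule_over_add[OF M] and M_diff = submodule_over_diff[OF M]
    and M_ev = submodule_over_eval_at[OF M] and M_0 = submodule_over_zero[OF M]
  define I where "I = {s. \<exists>m\<in>span_over w bs. eval_at w s * b + m \<in> A}"
  have I_diff: "s - t \<in> I" if "s \<in> I" "t \<in> I" for s t
  proof -
    from that obtain m m' where "m \<in> span_over w bs" "m' \<in> span_over w bs"
      "eval_at w s * b + m \<in> A" "eval_at w t * b + m' \<in> A" unfolding I_def by auto
    then have "eval_at w (s - t) * b + (m - m') \<in> A" "m - m' \<in> span_over w bs"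
      using A_diff[of "eval_at w s * b + m" "eval_at w t * b + m'"] M_diff
      by (auto simp: eval_at_diff algebra_simps)
    then show ?thesis unfolding I_def by auto
  qed
  have I_mult: "t * s \<in> I" if "s \<in> I" for s t
  proof -
    from that obtain m where "m \<in> span_over w bs" "eval_at w s * b + m \<in> A"
      unfolding I_def by auto
    then have "eval_at w (t * s) * b + eval_at w t * m \<in> A" "eval_at w t * m \<in> span_over w bs"
      using A_ev[of "eval_at w s * b + m" t] M_ev by (auto simp: eval_at_mult algebra_simps)
    then show ?thesis unfolding I_def by auto
  qed
  have I_0: "0 \<in> I" unfolding I_def using M_0 submodule_over_zero[OF A] by (auto intro!: bexI[of _ 0])
  from Cons.prems obtain s0 m0 where c: "c = eval_at w s0 * b + m0" and m0: "m0 \<in> span_over w bs"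
    by auto
  have in_I: "s0 - h * s \<in> I"
    if "c - eval_at w h * (eval_at w s * b + m) \<in> A" "m \<in> span_over w bs" for h s m
  proof -
    have "c - eval_at w h * (eval_at w s * b + m) = eval_at w (s0 - h * s) * b + (m0 - eval_at w h * m)"
      by (simp add: c eval_at_diff eval_at_mult algebra_simps)
    then show ?thesis unfolding I_def using that m0 M_diff M_ev by auto
  qed
  show ?case
  proof (cases "s0 \<in> I")
    case False
    show ?thesis
    proof (cases "I = {0}")
      case True
      with False have s0: "s0 \<noteq> 0" by auto
      \<comment> \<open>Any nonzero nonunit does: with \<open>I = {0}\<close>, membership would give
        \<open>s0 * (1 - X * s) = 0\<close>, hence \<open>X * s = 1\<close>.\<close>
      obtain X :: "'a poly" where X: "X \<noteq> 0" "\<And>s. X * s \<noteq> 1"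
      proof
        show "[:0, 1:] * s \<noteq> 1" for s :: "'a poly"
          by (simp add: one_pCons)
      qed simp
      have "c - eval_at w (X * s0) * m \<notin> A" if "m \<in> span_over w (b # bs)" for m
      proof
        assume *: "c - eval_at w (X * s0) * m \<in> A"
        from that obtain s m' where m: "m = eval_at w s * b + m'" "m' \<in> span_over w bs" by auto
        have "s0 - X * s0 * s \<in> I" using in_I[OF *[unfolded m(1)] m(2)] .
        then have "s0 * (1 - X * s) = 0" using True by (simp add: algebra_simps)
        then show False using s0 X(2)[of s] by auto
      qed
      then show ?thesis using s0 X by (intro exI[of _ "X * s0"]) auto
    next
      case nontriv: False
      then obtain g where g: "g \<in> I" "g \<noteq> 0" using I_0 by blast
      \<comment> \<open>Multiples of \<open>g\<close> lie in \<open>I\<close>, so subtracting one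
        cannot move \<open>s0\<close> into \<open>I\<close>.\<close>
      have "c - eval_at w g * m \<notin> A" if "m \<in> span_over w (b # bs)" for m
      proof
        assume *: "c - eval_at w g * m \<in> A"
        from that obtain s m' where m: "m = eval_at w s * b + m'" "m' \<in> span_over w bs" by auto
        have "s0 - g * s \<in> I" using in_I[OF *[unfolded m(1)] m(2)] .
        then have "s0 - g * s - (- s) * g \<in> I" using I_mult I_diff g by blast
        then show False using False by (simp add: mult.commute)
      qed
      then show ?thesis using g by auto
    qed
  next
    case True
    then obtain m1 where m1: "m1 \<in> span_over w bs" "eval_at w s0 * b + m1 \<in> A"
      unfolding I_def by auto
    \<comment> \<open>\<open>c'\<close> represents \<open>c\<close> modulo \<open>A\<close> without
      a \<open>b\<close>-term, so the induction hypothesis applies to it.\<close>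
    define c' where "c' = m0 - m1"
    have c_c': "c - c' \<in> A" using m1 by (simp add: c c'_def)
    have "c' \<notin> A" using c_c' A_add Cons.prems(2) by force
    then obtain h where h: "h \<noteq> 0" "\<And>m. m \<in> span_over w bs \<Longrightarrow> c' - eval_at w h * m \<notin> A"
      using Cons.IH[of c'] M_diff m0 m1 c'_def by auto
    \<comment> \<open>\<open>h\<close> handles the span of \<open>bs\<close>; the factor
      \<open>g\<close> controls the \<open>b\<close>-coefficient and is taken from \<open>I\<close>
      unless \<open>I\<close> is zero.\<close>
    obtain g where g: "g \<noteq> 0" "I \<noteq> {0} \<longrightarrow> g \<in> I"
      using I_0 by (cases "I = {0}") (metis one_neq_zero, blast)
    have "c - eval_at w (h * g) * m \<notin> A" if "m \<in> span_over w (b # bs)" for m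
    proof
      assume *: "c - eval_at w (h * g) * m \<in> A"
      from that obtain s m' where m: "m = eval_at w s * b + m'" "m' \<in> span_over w bs" by auto
      have **: "c' - eval_at w (h * g) * m \<in> A"
        using A_diff[OF * c_c'] by (simp add: algebra_simps)
      show False
      proof (cases "I = {0}")
        case True
        have "s0 - h * g * s \<in> I" using in_I[OF *[unfolded m(1)] m(2)] .
        moreover have "s0 = 0" using \<open>s0 \<in> I\<close> True by simp
        ultimately have "s = 0" using h g True by simp
        then have "c' - eval_at w h * (eval_at w g * m') \<in> A"
          using ** m by (simp add: eval_at_mult mult.assoc)
        then show False using h M_ev m by blast
      next
        case False
        with g have "g \<in> I" by simp
        then obtain m2 where m2: "m2 \<in> span_over w bs" "eval_at w g * b + m2 \<in> A"
          unfolding I_def by auto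
        \<comment> \<open>An element of \<open>A\<close> with \<open>b\<close>-coefficient
          \<open>g\<close> cancels the \<open>b\<close>-term of \<open>m\<close>; what remains to
          subtract is \<open>eval_at w h\<close> times an element of the span of
          \<open>bs\<close>.\<close>
        have "c' - eval_at w (h * g) * m + eval_at w (h * s) * (eval_at w g * b + m2) \<in> A"
          using ** A_ev m2 A_add by blast
        also have "c' - eval_at w (h * g) * m + eval_at w (h * s) * (eval_at w g * b + m2)
            = c' - eval_at w h * (eval_at w g * m' - eval_at w s * m2)"
          by (simp add: m eval_at_mult algebra_simps)
        finally show False using h M_diff M_ev m m2 by blast
      qed
    qed
    then show ?thesis using h g by (intro exI[of _ "h * g"]) auto
  qed
qed

lemma finite_polys_of_bounded_degree: "finite {s :: 'a::{finite, zero} poly. degree s \<le> n}"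
proof (rule finite_subset)
  show "{s :: 'a poly. degree s \<le> n} \<subseteq> Poly ` {xs. set xs \<subseteq> UNIV \<and> length xs \<le> Suc n}"
  proof
    fix s :: "'a poly" assume "s \<in> {s. degree s \<le> n}"
    then have "length (coeffs s) \<le> Suc n" by (cases "s = 0") (auto simp: length_coeffs_degree)
    then show "s \<in> Poly ` {xs. set xs \<subseteq> UNIV \<and> length xs \<le> Suc n}"
      by (intro image_eqI[of _ _ "coeffs s"]) auto
  qed
qed (intro finite_imageI finite_lists_length_le, simp)

text \<open>Division by \<open>h\<close> in each coefficient leaves remainders of bounded degree, of
  which a finite field admits only finitely many.\<close>

lemma finite_residues_span_over:
  fixes w :: "'a::{field_gcd, finite} poly poly"
  assumes h: "h \<noteq> 0"
  shows "\<exists>Z. finite Z \<and> (\<forall>m\<in>span_over w bs. \<exists>z\<in>Z. eval_at w h dvd m - z)"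
proof (induction bs)
  case (Cons b bs)
  then obtain Z where Z: "finite Z" "\<And>m. m \<in> span_over w bs \<Longrightarrow> \<exists>z\<in>Z. eval_at w h dvd m - z"
    by auto
  define Z' where "Z' = (\<lambda>(r, z). eval_at w r * b + z) ` ({r. degree r \<le> degree h} \<times> Z)"
  have "\<exists>z\<in>Z'. eval_at w h dvd m - z" if m: "m \<in> span_over w (b # bs)" for m
  proof -
    from m obtain s m' where s: "m = eval_at w s * b + m'" "m' \<in> span_over w bs" by auto
    with Z obtain z where z: "z \<in> Z" "eval_at w h dvd m' - z" by blast
    define r where "r = s mod h"
    have "degree r \<le> degree h"
      using degree_mod_less[OF h, of s] unfolding r_def by auto
    moreover have "m - (eval_at w r * b + z) = eval_at w h * (eval_at w (s div h) * b) + (m' - z)"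
    proof -
      have "s = h * (s div h) + r" by (simp add: r_def)
      then have "eval_at w s = eval_at w h * eval_at w (s div h) + eval_at w r"
        by (metis eval_at_add eval_at_mult)
      then show ?thesis by (simp add: s algebra_simps)
    qed
    then have "eval_at w h dvd m - (eval_at w r * b + z)" using z by (metis dvd_add dvd_triv_left)
    moreover have "eval_at w r * b + z \<in> Z'" if "degree r \<le> degree h"
      unfolding Z'_def using that z(1) by (intro image_eqI[of _ _ "(r, z)"]) auto
    ultimately show ?thesis by blast
  qed
  moreover have "finite Z'" unfolding Z'_def using Z(1) finite_polys_of_bounded_degree by blast
  ultimately show ?case by blast
qed (auto intro: exI[of _ "{0}"])

subsection \<open>Forms\<close>

text \<open>\<open>u\<close> is the sum of its monomials. Only those occurring in \<open>u\<close>
  have to lie in \<open>U\<close>, so a claim about a form needs checking only in its own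
  degree.\<close>

lemma bipoly_monomials_closure:
  fixes u :: "'a::comm_ring_1 poly poly"
  assumes zero: "0 \<in> U" and add: "\<And>u v. u \<in> U \<Longrightarrow> v \<in> U \<Longrightarrow> u + v \<in> U"
    and monom: "\<And>i j. coeff (coeff u j) i \<noteq> 0 \<Longrightarrow> monom (monom (coeff (coeff u j) i) i) j \<in> U"
  shows "u \<in> U"
proof -
  have sum: "sum h I \<in> U" if "\<And>i. i \<in> I \<Longrightarrow> h i \<in> U" for h :: "nat \<Rightarrow> _" and I
    using that by (induction I rule: infinite_finite_induct) (auto intro: zero add)
  have monom_sum: "monom (sum h I) j = (\<Sum>i\<in>I. monom (h i) j)" for h :: "nat \<Rightarrow> 'a poly" and I j
    by (induction I rule: infinite_finite_induct) (simp_all flip: add_monom)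
  have "monom (monom (coeff (coeff u j) i) i) j \<in> U" for i j
    using zero monom by (cases "coeff (coeff u j) i = 0") auto
  then have "(\<Sum>j\<le>degree u. \<Sum>i\<le>degree (coeff u j). monom (monom (coeff (coeff u j) i) i) j) \<in> U"
    by (intro sum)
  also have "(\<Sum>j\<le>degree u. \<Sum>i\<le>degree (coeff u j). monom (monom (coeff (coeff u j) i) i) j)
      = (\<Sum>j\<le>degree u. monom (\<Sum>i\<le>degree (coeff u j). monom (coeff (coeff u j) i) i) j)"
    by (simp add: monom_sum)
  also have "\<dots> = u" by (simp add: poly_as_sum_of_monoms)
  finally show ?thesis .
qed

text \<open>Unlike \<open>homogeneous_of_degree\<close>, this includes the zero polynomial, so that
  forms of one degree are closed under addition.\<close>

definition forms :: "nat \<Rightarrow> 'a::zero poly poly set" where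
  "forms e = {u. \<forall>i j. coeff (coeff u j) i \<noteq> 0 \<longrightarrow> i + j = e}"

lemma formsD: "u \<in> forms e \<Longrightarrow> i + j \<noteq> e \<Longrightarrow> coeff (coeff u j) i = 0"
  unfolding forms_def by auto

lemma forms_monom: "monom (monom c i) j \<in> forms (i + j)"
  unfolding forms_def by auto

lemma forms_add: "u \<in> forms e \<Longrightarrow> v \<in> forms e \<Longrightarrow> u + v \<in> forms e"
  and forms_diff: "u' \<in> forms e \<Longrightarrow> v' \<in> forms e \<Longrightarrow> u' - v' \<in> forms e"
  for u v :: "'a::comm_monoid_add poly poly" and u' v' :: "'b::ab_group_add poly poly"
  unfolding forms_def by (auto, metis add.right_neutral, metis diff_0_right)

text \<open>\<open>grade u\<close> is \<open>u(tx, ty)\<close> as a polynomial in \<open>t\<close>. Its multiplicativity replaces arguments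
  about leading forms.\<close>

definition subst_x :: "'a::comm_ring_1 poly \<Rightarrow> 'a poly poly poly" where
  "subst_x a = poly (map_poly (\<lambda>c. [:const c:]) a) (monom [:[:0, 1:]:] 1)"

definition grade :: "'a::comm_ring_1 poly poly \<Rightarrow> 'a poly poly poly" where
  "grade u = poly (map_poly subst_x u) (monom [:0, 1:] 1)"

interpretation const3: comm_ring_hom "\<lambda>c. [:const c:]"
  by unfold_locales (auto simp: one_pCons)

interpretation map_const3: map_poly_comm_ring_hom "\<lambda>c. [:const c:]" ..

interpretation subst_x: comm_ring_hom subst_x
  by unfold_locales
     (auto simp: subst_x_def map_const3.hom_add map_const3.hom_mult)

interpretation map_subst_x: map_poly_comm_ring_hom subst_x ..

interpretation grade: comm_ring_hom grade
  by unfold_locales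
     (auto simp: grade_def map_subst_x.hom_add map_subst_x.hom_mult)

lemma grade_monom: "grade (monom (monom c i) j) = monom (monom (monom c i) j) (i + j)"
proof -
  have "[:[:0, 1::'a:]:] ^ i = [:monom 1 i:]" for i
    by (simp add: poly_const_pow monom_altdef)
  then have "subst_x (monom c i) = [:const c:] * monom [:monom 1 i:] i"
    by (simp add: subst_x_def map_poly_monom poly_monom monom_power)
  moreover have "[:0, 1::'a poly:] ^ j = monom 1 j" by (simp add: monom_altdef)
  ultimately show ?thesis
    by (simp add: grade_def map_poly_monom poly_monom monom_power mult_monom smult_monom)
qed

lemma grade_form:
  fixes u :: "'a::comm_ring_1 poly poly"
  assumes "u \<in> forms e"
  shows "grade u = monom u e"
proof -
  have "u \<in> {u. grade u = monom u e}"
  proof (rule bipoly_monomials_closure)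
    fix i j assume "coeff (coeff u j) i \<noteq> 0"
    then have "i + j = e" using formsD[OF assms] by blast
    then show "monom (monom (coeff (coeff u j) i) i) j \<in> {u. grade u = monom u e}"
      by (simp add: grade_monom)
  qed (auto simp: grade.hom_add add_monom)
  then show ?thesis by simp
qed

text \<open>The coefficients of \<open>grade u\<close> in the grading variable are the homogeneous
  components of \<open>u\<close>.\<close>

lemma coeff_grade:
  fixes u :: "'a::comm_ring_1 poly poly"
  shows "coeff (coeff (coeff (grade u) d) j) i = (if i + j = d then coeff (coeff u j) i else 0)"
proof -
  have "u \<in> {u. \<forall>d j i. coeff (coeff (coeff (grade u) d) j) i
      = (if i + j = d then coeff (coeff u j) i else 0)}"
    by (rule bipoly_monomials_closure) (auto simp: grade.hom_add grade_monom)
  then show ?thesis by simp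
qed

lemma form_iff_grade: "u \<in> forms e \<longleftrightarrow> (\<exists>v. grade u = monom v e)"
  for u :: "'a::comm_ring_1 poly poly"
proof
  assume "\<exists>v. grade u = monom v e"
  then obtain v where v: "grade u = monom v e" by auto
  have "i + j = e" if "coeff (coeff u j) i \<noteq> 0" for i j
    using coeff_grade[of u "i + j" j i] that by (auto simp: v split: if_splits)
  then show "u \<in> forms e" by (auto simp: forms_def)
qed (use grade_form in blast)

lemma forms_mult: "u \<in> forms d \<Longrightarrow> v \<in> forms e \<Longrightarrow> u * v \<in> forms (d + e)"
  for u v :: "'a::comm_ring_1 poly poly"
  unfolding form_iff_grade by (auto simp: grade.hom_mult mult_monom)

text \<open>For \<open>n > 0\<close> the constant coefficient of one factor vanishes, so that factor
  gives up a power of the variable and induction applies.\<close>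

lemma monom_factor:
  fixes p q :: "'a::idom poly"
  assumes "p * q = monom c n" "c \<noteq> 0"
  shows "\<exists>d k. p = monom d k"
  using assms
proof (induction n arbitrary: p q)
  case 0
  then have "degree p = 0"
    by (metis add_is_0 degree_mult_eq degree_monom_eq monom_eq_0_iff mult_zero_left mult_zero_right)
  then show ?case by (metis degree_eq_zeroE monom_0)
next
  case (Suc n)
  have "coeff (p * q) 0 = 0" using Suc.prems by simp
  then consider "coeff p 0 = 0" | "coeff q 0 = 0" by (auto simp: coeff_mult_0)
  then show ?case
  proof cases
    case 1
    then obtain p' where p': "p = pCons 0 p'" by (metis coeff_pCons_0 pCons_cases)
    with Suc.prems have "p' * q = monom c n" by (simp add: monom_Suc)
    with Suc obtain d k where "p' = monom d k" by blast
    then show ?thesis using p' by (metis monom_Suc)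
  next
    case 2
    then obtain q' where q': "q = pCons 0 q'" by (metis coeff_pCons_0 pCons_cases)
    with Suc.prems have "p * q' = monom c n" by (simp add: monom_Suc)
    with Suc show ?thesis by blast
  qed
qed

text \<open>\<open>grade\<close> is multiplicative and sends a form to a monomial, whose factors
  over a domain are monomials.\<close>

lemma form_factor:
  fixes g h :: "'a::idom poly poly"
  assumes "g * h \<in> forms n" "g * h \<noteq> 0"
  shows "\<exists>e. g \<in> forms e"
proof -
  have "grade g * grade h = monom (g * h) n"
    using grade_form[OF assms(1)] by (simp add: grade.hom_mult)
  then show ?thesis using monom_factor assms(2) form_iff_grade by metis
qed

text \<open>Compare degrees in the grading variable: the factor \<open>grade g\<close> contributes
  \<open>e\<close>, while \<open>grade u\<close> has degree only \<open>d\<close> if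
  \<open>u\<close> is nonzero.\<close>

lemma form_dvd_form_of_smaller_degree:
  fixes g u :: "'a::idom poly poly"
  assumes g: "g \<in> forms e" and u: "u \<in> forms d" and "d < e" "g dvd u"
  shows "u = 0"
proof (rule ccontr)
  assume "u \<noteq> 0"
  obtain k where k: "u = g * k" using \<open>g dvd u\<close> by (elim dvdE)
  have eq: "monom u d = monom g e * grade k"
    using grade_form[OF u] grade_form[OF g] by (simp add: k grade.hom_mult)
  then have "monom g e * grade k \<noteq> 0" using \<open>u \<noteq> 0\<close> by (metis monom_eq_0_iff)
  then have "degree (monom u d) \<ge> e" "g \<noteq> 0"
    by (auto simp: eq degree_mult_eq degree_monom_eq)
  then show False using \<open>d < e\<close> \<open>u \<noteq> 0\<close> by (simp add: degree_monom_eq)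
qed

text \<open>Serves to count forms, since surjectivity is obtained below from injectivity by
  comparing cardinalities.\<close>

lemma bij_betw_forms:
  "bij_betw (\<lambda>a. \<Sum>j\<le>e. monom (monom (a j) (e - j)) j) ({..e} \<rightarrow>\<^sub>E UNIV)
     (forms e :: 'a::comm_ring_1 poly poly set)"
proof (rule bij_betwI[where g = "\<lambda>u. \<lambda>j\<in>{..e}. coeff (coeff u j) (e - j)"])
  show "(\<lambda>a. \<Sum>j\<le>e. monom (monom (a j) (e - j)) j) \<in> ({..e} \<rightarrow>\<^sub>E UNIV) \<rightarrow> (forms e :: 'a poly poly set)"
    by (auto simp: forms_def coeff_sum if_distrib cong: if_cong split: if_splits)
next
  fix a :: "nat \<Rightarrow> 'a" assume "a \<in> {..e} \<rightarrow>\<^sub>E UNIV"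
  then show "(\<lambda>j\<in>{..e}. coeff (coeff (\<Sum>j\<le>e. monom (monom (a j) (e - j)) j) j) (e - j)) = a"
    by (auto simp: fun_eq_iff coeff_sum restrict_def PiE_def extensional_def if_distrib cong: if_cong)
next
  fix u :: "'a poly poly" assume u: "u \<in> forms e"
  show "(\<Sum>j\<le>e. monom (monom ((\<lambda>j\<in>{..e}. coeff (coeff u j) (e - j)) j) (e - j)) j) = u"
  proof (rule poly_eqI, rule poly_eqI)
    fix j i
    have "coeff (coeff u j) i = 0" if "j > e \<or> i \<noteq> e - j"
      using formsD[OF u, of i j] that by auto
    then show "coeff (coeff (\<Sum>j\<le>e. monom (monom ((\<lambda>j\<in>{..e}. coeff (coeff u j) (e - j)) j) (e - j)) j) j) i
        = coeff (coeff u j) i"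
      by (auto simp: coeff_sum if_distrib cong: if_cong)
  qed
qed auto

lemma card_forms: "card (forms e :: 'a::{comm_ring_1, finite} poly poly set) = CARD('a) ^ Suc e"
  using bij_betw_same_card[OF bij_betw_forms[where ?'a = 'a]] by (simp add: card_PiE)

lemma finite_forms: "finite (forms e :: 'a::{comm_ring_1, finite} poly poly set)"
  using bij_betw_finite[OF bij_betw_forms[where ?'a = 'a]] by (simp add: finite_PiE)

text \<open>Instead of the Sylvester determinant: the map \<open>(a, b) \<mapsto> v a + g b\<close> is injective on
  \<open>forms (e - 1) \<times> forms (d - 1)\<close>, which has as many elements as \<open>forms (d + e - 1)\<close>.\<close>

lemma form_in_ideal_of_coprime_forms:
  fixes g v u :: "'a::{field, finite} poly poly"
  assumes g: "g \<in> forms e" "prime_elem g" and v: "v \<in> forms d" "\<not> g dvd v"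
    and "e \<ge> 1" "d \<ge> 1" and u: "u \<in> forms (d + e - 1)"
  shows "\<exists>a b. a \<in> forms (e - 1) \<and> u = v * a + g * b"
proof -
  define F where "F = (\<lambda>(a, b). v * a + g * b)"
  let ?D = "forms (e - 1) \<times> forms (d - 1) :: ('a poly poly \<times> 'a poly poly) set"
  have "inj_on F ?D"
  proof (rule inj_onI, clarify)
    fix a b a' b' :: "'a poly poly"
    assume *: "a \<in> forms (e - 1)" "a' \<in> forms (e - 1)" "F (a, b) = F (a', b')"
    then have eq: "v * (a - a') = g * (b' - b)" by (simp add: F_def algebra_simps)
    \<comment> \<open>As \<open>g\<close> is prime and does not divide \<open>v\<close>, it divides
      \<open>a - a'\<close>, a form of degree below \<open>e\<close>, which must vanish.\<close>
    then have "g dvd v * (a - a')" by simp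
    then have "g dvd a - a'" using g v by (auto simp: prime_elem_dvd_mult_iff)
    moreover have "a - a' \<in> forms (e - 1)" using * forms_diff by blast
    ultimately have "a = a'"
      using form_dvd_form_of_smaller_degree[OF g(1), of "a - a'" "e - 1"] \<open>e \<ge> 1\<close> by simp
    moreover have "g \<noteq> 0" using g by auto
    ultimately show "a = a' \<and> b = b'" using eq by simp
  qed
  moreover have "F ` ?D \<subseteq> forms (d + e - 1)"
  proof clarify
    fix a b :: "'a poly poly" assume *: "a \<in> forms (e - 1)" "b \<in> forms (d - 1)"
    have "v * a \<in> forms (d + e - 1)" "g * b \<in> forms (d + e - 1)"
      using forms_mult[OF v(1) *(1)] forms_mult[OF g(1) *(2)] \<open>e \<ge> 1\<close> \<open>d \<ge> 1\<close>
      by (simp_all add: add.commute)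
    then show "F (a, b) \<in> forms (d + e - 1)" unfolding F_def by (auto intro: forms_add)
  qed
  \<comment> \<open>Both sides are \<open>CARD('a)\<close> to the power \<open>d + e\<close>; this
    is what singles out the degree \<open>d + e - 1\<close>.\<close>
  moreover have "card (forms (d + e - 1) :: 'a poly poly set) = card ?D"
    using \<open>e \<ge> 1\<close> \<open>d \<ge> 1\<close> by (simp add: card_cartesian_product card_forms add.commute flip: power_add)
  ultimately have "F ` ?D = forms (d + e - 1)"
    using finite_forms by (metis card_image card_subset_eq)
  with u have "u \<in> F ` ?D" by simp
  then show ?thesis unfolding F_def by auto
qed

subsection \<open>Finite generation modulo a product of forms\<close>

text \<open>Generation is expressed by the submodules that contain the generators, rather than by linear
  combinations, because this form composes directly in \<open>finitely_generated_mod_mult\<close>.\<close>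

definition finitely_generated_mod :: "'a::comm_ring_1 poly poly \<Rightarrow> 'a poly poly \<Rightarrow> bool" where
  "finitely_generated_mod w f \<longleftrightarrow>
     (\<exists>B. finite B \<and> (\<forall>U. submodule_over w U \<and> range ((*) f) \<subseteq> U \<and> B \<subseteq> U \<longrightarrow> U = UNIV))"

lemma sum_coeff_grade: "(\<Sum>k\<le>degree (grade w). coeff (grade w) k) = w"
proof (rule poly_eqI, rule poly_eqI)
  fix j i
  have "coeff (coeff (\<Sum>k\<le>degree (grade w). coeff (grade w) k) j) i
      = (if i + j \<le> degree (grade w) then coeff (coeff w j) i else 0)"
    by (simp add: coeff_sum coeff_grade)
  also have "\<dots> = coeff (coeff w j) i"
    using coeff_grade[of w "i + j" j i] by (auto simp: coeff_eq_0)
  finally show "coeff (coeff (\<Sum>k\<le>degree (grade w). coeff (grade w) k) j) i = coeff (coeff w j) i" .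
qed

lemma coeff_grade_in_forms: "coeff (grade w) k \<in> forms k"
  by (auto simp: forms_def coeff_grade split: if_splits)

lemma submodule_over_sum:
  assumes "submodule_over w A" "\<And>i. i \<in> I \<Longrightarrow> h i \<in> A"
  shows "sum h I \<in> A"
  using assms(2) submodule_over_zero[OF assms(1)] submodule_over_add[OF assms(1)]
  by (induction I rule: infinite_finite_induct) auto

text \<open>\<open>v\<close> is the highest homogeneous component of \<open>w\<close> that
  \<open>g\<close> does not divide; those above it vanish modulo \<open>g\<close>. As
  \<open>w\<close> has no constant term, \<open>d\<close> is positive.\<close>

lemma exists_leading_form_mod:
  fixes g w :: "'a::idom poly poly"
  assumes "\<not> g dvd w" and "zero_const_term w"
  obtains d v r where "d \<ge> 1" "v \<in> forms d" "\<not> g dvd v" "g dvd w - (v + (\<Sum>k<d. r k))"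
    "\<And>k. r k \<in> forms k"
proof -
  define r where "r = coeff (grade w)"
  define N where "N = degree (grade w)"
  define D where "D = {k. k \<le> N \<and> \<not> g dvd r k}"
  have w: "w = (\<Sum>k\<le>N. r k)" unfolding r_def N_def by (rule sum_coeff_grade[symmetric])
  have "finite D" unfolding D_def by simp
  moreover have "D \<noteq> {}" using assms(1) unfolding w D_def by (auto intro: dvd_sum)
  ultimately have D: "Max D \<in> D" "\<And>k. k \<in> D \<Longrightarrow> k \<le> Max D" by auto
  define d where "d = Max D"
  have "r 0 = 0"
  proof (intro poly_eqI)
    show "coeff (coeff (r 0) j) i = coeff (coeff 0 j) i" for i j
      using assms(2) by (simp add: r_def coeff_grade)
  qed
  moreover have "\<not> g dvd r d" "d \<le> N" using D(1) by (auto simp: D_def d_def)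
  ultimately have "d \<noteq> 0" by (metis dvd_0_right)
  have split: "{..N} = insert d {..<d} \<union> {d<..N}" using \<open>d \<le> N\<close> by auto
  have "w - (r d + (\<Sum>k<d. r k)) = (\<Sum>k\<in>{d<..N}. r k)"
    unfolding w split by (subst sum.union_disjoint) auto
  also have "g dvd \<dots>"
  proof (rule dvd_sum)
    fix k assume "k \<in> {d<..N}"
    then have "k \<notin> D" "k \<le> N" using D(2)[of k] by (auto simp: d_def)
    then show "g dvd r k" unfolding D_def by blast
  qed
  finally have "g dvd w - (r d + (\<Sum>k<d. r k))" .
  moreover have "r k \<in> forms k" for k unfolding r_def by (rule coeff_grade_in_forms)
  ultimately show ?thesis
    using that[of d "r d" r] \<open>\<not> g dvd r d\<close> \<open>d \<noteq> 0\<close> by fastforce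
qed

text \<open>Monomials of degree below \<open>M\<close> suffice as generators. Modulo
  \<open>g\<close>, a monomial of degree \<open>n \<ge> M\<close> is a multiple of the leading form
  \<open>v\<close>, and replacing \<open>v\<close> by \<open>w\<close> changes it only by terms of
  lower degree; so induction on the degree applies.\<close>

lemma finitely_generated_mod_prime_form:
  fixes g w :: "'a::{field, finite} poly poly"
  assumes g: "g \<in> forms e" "prime_elem g" "e \<ge> 1"
    and w: "\<not> g dvd w" "zero_const_term w"
  shows "finitely_generated_mod w g"
proof -
  obtain d v r where d: "d \<ge> 1" "v \<in> forms d" "\<not> g dvd v"
    and wv: "g dvd w - (v + (\<Sum>k<d. r k))" and r: "\<And>k. r k \<in> forms k"
    using exists_leading_form_mod[OF w] by metis
  define M where "M = d + e - 1"
  define B where "B = (\<lambda>(c::'a, i, j). monom (monom c i) j) ` (UNIV \<times> {..<M} \<times> {..<M})"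
  have "U = UNIV" if U: "submodule_over w U" "range ((*) g) \<subseteq> U" "B \<subseteq> U" for U
  proof -
    note U_0 = submodule_over_zero[OF U(1)] and U_add = submodule_over_add[OF U(1)]
      and U_diff = submodule_over_diff[OF U(1)] and U_w = submodule_over_mult[OF U(1)]
    have gU: "u \<in> U" if "g dvd u" for u using that U(2) by (auto elim!: dvdE)
    have mU: "monom (monom c i) j \<in> U" if "n = i + j" for c i j n
      using that
    proof (induction n arbitrary: c i j rule: less_induct)
      case (less n)
      have lower: "forms k \<subseteq> U" if "k < n" for k
      proof
        fix u :: "'a poly poly" assume "u \<in> forms k"
        then have "monom (monom (coeff (coeff u j) i) i) j \<in> U" if "coeff (coeff u j) i \<noteq> 0" for i j
          using less.IH[OF \<open>k < n\<close>, of i j] formsD[of u k i j] that by blast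
        then show "u \<in> U" by (rule bipoly_monomials_closure[OF U_0, rotated]) (assumption | rule U_add)+
      qed
      show ?case
      proof (cases "n < M")
        case True
        then show ?thesis
          using less.prems U(3) unfolding B_def by (auto intro!: image_eqI[of _ _ "(c, i, j)"])
      next
        case False
        \<comment> \<open>Split off a divisor of degree exactly \<open>M = d + e - 1\<close>, where
          every form lies in the ideal of \<open>v\<close> and \<open>g\<close>.\<close>
        define i1 where "i1 = min i M"
        define j1 where "j1 = M - i1"
        define m2 :: "'a poly poly" where "m2 = monom (monom 1 (i - i1)) (j - j1)"
        have le: "i1 \<le> i" "j1 \<le> j" "i1 + j1 = M"
          using False less.prems by (auto simp: i1_def j1_def)
        then have m: "monom (monom c i) j = monom (monom c i1) j1 * m2"
          by (simp add: m2_def mult_monom)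
        have "monom (monom c i1) j1 \<in> forms (d + e - 1)"
          using forms_monom[of c i1 j1] le by (simp add: M_def)
        then obtain a b where ab: "a \<in> forms (e - 1)" "monom (monom c i1) j1 = v * a + g * b"
          using form_in_ideal_of_coprime_forms[OF g(1,2) d(2,3) g(3) d(1)] by blast
        have "a * m2 \<in> forms (e - 1 + ((i - i1) + (j - j1)))"
          unfolding m2_def by (intro forms_mult ab forms_monom)
        also have "e - 1 + ((i - i1) + (j - j1)) = n - d"
          using le d(1) g(3) less.prems by (simp add: M_def)
        finally have am: "a * m2 \<in> forms (n - d)" .
        have "n \<ge> d" using False g(3) by (simp add: M_def)
        \<comment> \<open>Here \<open>d \<ge> 1\<close> matters: \<open>a * m2\<close> has degree
          below \<open>n\<close>, so it is already in \<open>U\<close>, and so is its multiple by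
          \<open>w\<close>.\<close>
        have "w * (a * m2) \<in> U" using am lower[of "n - d"] \<open>n \<ge> d\<close> d(1) by (intro U_w) auto
        moreover have "(\<Sum>k<d. r k) * (a * m2) \<in> U"
          unfolding sum_distrib_right
        proof (rule submodule_over_sum[OF U(1)])
          fix k assume "k \<in> {..<d}"
          then have "k + (n - d) < n" using \<open>n \<ge> d\<close> by auto
          then show "r k * (a * m2) \<in> U" using forms_mult[OF r am, of k] lower by blast
        qed
        moreover have "(w - (v + (\<Sum>k<d. r k))) * (a * m2) \<in> U" using wv by (intro gU) auto
        moreover have "g * (b * m2) \<in> U" by (intro gU) auto
        \<comment> \<open>The four elements combine to \<open>(v * a + g * b) * m2\<close>, the
          given monomial.\<close>
        ultimately have "w * (a * m2) - (\<Sum>k<d. r k) * (a * m2)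
            - (w - (v + (\<Sum>k<d. r k))) * (a * m2) + g * (b * m2) \<in> U"
          by (intro U_add U_diff)
        then show ?thesis by (simp add: m ab(2) algebra_simps)
      qed
    qed
    have "u \<in> U" for u by (rule bipoly_monomials_closure) (use U_0 U_add mU in auto)
    then show ?thesis by auto
  qed
  moreover have "finite B" unfolding B_def by auto
  ultimately show ?thesis unfolding finitely_generated_mod_def by blast
qed

lemma finitely_generated_mod_1: "finitely_generated_mod w 1"
  unfolding finitely_generated_mod_def by auto

text \<open>\<open>B\<close> generates modulo \<open>g\<close>, and multiplication by
  \<open>g\<close> carries the generators \<open>C\<close> modulo \<open>h\<close> to generators of
  the multiples of \<open>g\<close> modulo \<open>g * h\<close>.\<close>

lemma finitely_generated_mod_mult:
  assumes "finitely_generated_mod w g" "finitely_generated_mod w h"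
  shows "finitely_generated_mod w (g * h)"
proof -
  from assms obtain B C where B: "finite B"
      "\<And>U. submodule_over w U \<Longrightarrow> range ((*) g) \<subseteq> U \<Longrightarrow> B \<subseteq> U \<Longrightarrow> U = UNIV"
    and C: "finite C" "\<And>U. submodule_over w U \<Longrightarrow> range ((*) h) \<subseteq> U \<Longrightarrow> C \<subseteq> U \<Longrightarrow> U = UNIV"
    unfolding finitely_generated_mod_def by metis
  have "U = UNIV" if U: "submodule_over w U" "range ((*) (g * h)) \<subseteq> U" "B \<union> (*) g ` C \<subseteq> U" for U
  proof (rule B(2)[OF U(1)])
    have "{u. g * u \<in> U} = UNIV"
    proof (rule C(2))
      show "submodule_over w {u. g * u \<in> U}"
      proof (rule submodule_overI; clarify)
        show "g * 0 \<in> U" using submodule_over_zero[OF U(1)] by simp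
        show "g * (u + v) \<in> U" if "g * u \<in> U" "g * v \<in> U" for u v
          using submodule_over_add[OF U(1) that] by (simp add: distrib_left)
        show "g * (const c * u) \<in> U" if "g * u \<in> U" for c u
          using submodule_over_const_mult[OF U(1) that] by (simp only: ac_simps)
        show "g * (w * u) \<in> U" if "g * u \<in> U" for u
          using submodule_over_mult[OF U(1) that] by (simp only: ac_simps)
      qed
    qed (use U in \<open>auto simp: mult.assoc\<close>)
    then show "range ((*) g) \<subseteq> U" by auto
  qed (use U in auto)
  moreover have "finite (B \<union> (*) g ` C)" using B C by auto
  ultimately show ?thesis
    unfolding finitely_generated_mod_def by (intro exI[of _ "B \<union> (*) g ` C"]) simp
qed

lemma finitely_generated_mod_prod:
  "(\<And>g. g \<in> S \<Longrightarrow> finitely_generated_mod w g) \<Longrightarrow> finitely_generated_mod w (\<Prod>S)"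
  by (induction S rule: infinite_finite_induct)
     (auto intro: finitely_generated_mod_1 finitely_generated_mod_mult)

section \<open>Separation by ideals of finite index\<close>

definition cofinite_ideal :: "'r::comm_ring_1 set \<Rightarrow> bool" where
  "cofinite_ideal J \<longleftrightarrow> 0 \<in> J \<and> (\<forall>u\<in>J. \<forall>v\<in>J. u + v \<in> J) \<and> (\<forall>u\<in>J. \<forall>r. r * u \<in> J) \<and>
     (\<exists>Z. finite Z \<and> (\<forall>u. \<exists>z\<in>Z. u - z \<in> J))"

text \<open>Modulo \<open>f\<close> everything lies in a finitely generated span. If
  \<open>h\<close> separates a representative of \<open>c\<close> from \<open>A\<close> there, the
  ideal generated by \<open>f\<close> and \<open>w * eval_at w h\<close> separates \<open>c\<close>
  from \<open>A\<close>; its index is finite by division with remainder.\<close>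

lemma separating_cofinite_ideal:
  fixes w f :: "'a::{field_gcd, finite} poly poly"
  assumes fg: "finitely_generated_mod w f"
    and w0: "zero_const_term w" and f0: "zero_const_term f"
    and A: "submodule_over w A" "range ((*) f) \<subseteq> A" and c: "c \<notin> A"
  shows "\<exists>J. cofinite_ideal J \<and> range ((*) f) \<subseteq> J \<and> (\<forall>u\<in>J. zero_const_term u) \<and>
    (\<forall>a\<in>A. c - a \<notin> J)"
proof -
  note A_add = submodule_over_add[OF A(1)] and A_diff = submodule_over_diff[OF A(1)]
  have fA: "u \<in> A" if "f dvd u" for u using that A(2) by (auto elim!: dvdE)
  obtain bs where bs: "\<And>U. submodule_over w U \<Longrightarrow> range ((*) f) \<subseteq> U \<Longrightarrow> set bs \<subseteq> U \<Longrightarrow> U = UNIV"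
    using fg unfolding finitely_generated_mod_def by (metis finite_list)
  note M = submodule_over_span[of w bs]
  \<comment> \<open>The elements congruent to a member of the span form a submodule that contains
    all generators.\<close>
  have "{u. \<exists>m\<in>span_over w bs. f dvd u - m} = UNIV"
  proof (rule bs)
    show "submodule_over w {u. \<exists>m\<in>span_over w bs. f dvd u - m}"
    proof (rule submodule_overI; clarify)
      show "\<exists>m\<in>span_over w bs. f dvd 0 - m"
        using submodule_over_zero[OF M] by (intro bexI[of _ 0]) auto
    next
      fix u v m m' assume *: "m \<in> span_over w bs" "m' \<in> span_over w bs" "f dvd u - m" "f dvd v - m'"
      have "u + v - (m + m') = (u - m) + (v - m')" by simp
      then have "f dvd u + v - (m + m')" using * by (metis dvd_add)
      then show "\<exists>m\<in>span_over w bs. f dvd u + v - m"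
        using submodule_over_add[OF M *(1,2)] by blast
    next
      fix c u m assume *: "m \<in> span_over w bs" "f dvd u - m"
      then have "f dvd const c * u - const c * m" by (metis dvd_mult right_diff_distrib)
      then show "\<exists>m\<in>span_over w bs. f dvd const c * u - m"
        using submodule_over_const_mult[OF M *(1)] by blast
    next
      fix u m assume *: "m \<in> span_over w bs" "f dvd u - m"
      then have "f dvd w * u - w * m" by (metis dvd_mult right_diff_distrib)
      then show "\<exists>m\<in>span_over w bs. f dvd w * u - m"
        using submodule_over_mult[OF M *(1)] by blast
    qed
    show "range ((*) f) \<subseteq> {u. \<exists>m\<in>span_over w bs. f dvd u - m}"
      using submodule_over_zero[OF M] by force
    show "set bs \<subseteq> {u. \<exists>m\<in>span_over w bs. f dvd u - m}"
      using set_subset_span_over[of bs w] by (auto intro!: bexI[of _ "_ :: 'a poly poly"])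
  qed
  then have span: "\<exists>m\<in>span_over w bs. f dvd u - m" for u by blast
  obtain m where m: "m \<in> span_over w bs" "f dvd c - m" using span by blast
  then have "m \<notin> A" using A_add[of m "c - m"] fA c by auto
  then obtain h where h: "h \<noteq> 0" "\<And>m'. m' \<in> span_over w bs \<Longrightarrow> m - eval_at w h * m' \<notin> A"
    using separate_in_span_over[OF A(1) m(1)] by blast
  \<comment> \<open>The extra factor \<open>X\<close> makes \<open>eval_at w k\<close> a multiple of
    \<open>w\<close>, so that all elements of \<open>J\<close> have zero constant term.\<close>
  define k where "k = [:0, 1:] * h"
  have k: "eval_at w k = w * eval_at w h" by (simp only: k_def eval_at_mult eval_at_X)
  obtain Z where Z: "finite Z" "\<And>m. m \<in> span_over w bs \<Longrightarrow> \<exists>z\<in>Z. eval_at w k dvd m - z"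
    using finite_residues_span_over[of k w bs] h(1) by (auto simp: k_def)
  define J where "J = {eval_at w k * u + f * v | u v. True}"
  have "c - a \<notin> J" if a: "a \<in> A" for a
  proof
    assume "c - a \<in> J"
    then obtain u v where uv: "c - a = eval_at w k * u + f * v" by (auto simp: J_def)
    obtain m' where m': "m' \<in> span_over w bs" "f dvd w * u - m'" using span by blast
    \<comment> \<open>Modulo \<open>f\<close>, \<open>w * u\<close> may be replaced by
      \<open>m'\<close> in the span; every term on the right is in \<open>A\<close> or a multiple of
      \<open>f\<close>, contradicting the choice of \<open>h\<close>.\<close>
    have "m - eval_at w h * m' = a + f * v - (c - m) + eval_at w h * (w * u - m')"
      using uv by (simp add: k algebra_simps)
    also have "\<dots> \<in> A"
      using A_add[OF A_diff[OF A_add[OF a fA] fA[OF m(2)]] fA] m'(2) by simp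
    finally show False using h(2) m'(1) by blast
  qed
  moreover have "\<exists>z\<in>Z. u - z \<in> J" for u
  proof -
    obtain m' where m': "m' \<in> span_over w bs" "f dvd u - m'" using span by blast
    then obtain z where "z \<in> Z" "eval_at w k dvd m' - z" using Z by blast
    then obtain q s where "u - m' = f * q" "m' - z = eval_at w k * s" using m' by (auto elim!: dvdE)
    then have "u - z = eval_at w k * s + f * q" by (metis add.commute diff_add_cancel add_diff_eq)
    then show ?thesis using \<open>z \<in> Z\<close> unfolding J_def by blast
  qed
  moreover have "0 \<in> J" unfolding J_def by (auto intro!: exI[of _ 0])
  moreover have "u + v \<in> J" if "u \<in> J" "v \<in> J" for u v
  proof -
    from that obtain a b a' b' where "u = eval_at w k * a + f * b" "v = eval_at w k * a' + f * b'"
      unfolding J_def by blast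
    then have "u + v = eval_at w k * (a + a') + f * (b + b')" by (simp add: algebra_simps)
    then show ?thesis unfolding J_def by blast
  qed
  moreover have "r * u \<in> J" if "u \<in> J" for u r
  proof -
    from that obtain a b where "u = eval_at w k * a + f * b" unfolding J_def by blast
    then have "r * u = eval_at w k * (r * a) + f * (r * b)" by (simp add: algebra_simps)
    then show ?thesis unfolding J_def by blast
  qed
  moreover have "range ((*) f) \<subseteq> J"
  proof clarify
    fix v have "f * v = eval_at w k * 0 + f * v" by simp
    then show "f * v \<in> J" unfolding J_def by blast
  qed
  moreover have "zero_const_term u" if "u \<in> J" for u
    using that w0 f0 by (auto simp: J_def k coeff_mult_0)
  ultimately show ?thesis using Z(1) unfolding cofinite_ideal_def
    by (intro exI[of _ J] conjI ballI allI exI[of _ Z]) auto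
qed

subsection \<open>Subrings modulo a squarefree form\<close>

text \<open>Prime avoidance without units: if \<open>w\<close> avoids \<open>T\<close>, then a prime in \<open>T\<close> divides at most one of
  the elements \<open>w\<^sup>j + v\<close>, since it would otherwise divide some \<open>w\<^sup>i (1 - w\<^sup>s)\<close>.\<close>

lemma exists_element_avoiding_primes:
  fixes A :: "'r::idom set"
  assumes "finite T" and "A \<noteq> {}"
    and add: "\<And>u v. u \<in> A \<Longrightarrow> v \<in> A \<Longrightarrow> u + v \<in> A"
    and mult: "\<And>u v. u \<in> A \<Longrightarrow> v \<in> A \<Longrightarrow> u * v \<in> A"
    and prime: "\<And>g. g \<in> T \<Longrightarrow> prime_elem g"
    and proper: "\<And>g. g \<in> T \<Longrightarrow> \<exists>a\<in>A. \<not> g dvd a"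
    and not_one: "\<And>g u. g \<in> T \<Longrightarrow> u \<in> A \<Longrightarrow> \<not> g dvd 1 - u"
  shows "\<exists>w\<in>A. \<forall>g\<in>T. \<not> g dvd w"
  using assms(1) prime proper not_one
proof (induction T)
  case empty
  then show ?case using \<open>A \<noteq> {}\<close> by auto
next
  case (insert g T)
  then obtain w where w: "w \<in> A" "\<And>t. t \<in> T \<Longrightarrow> \<not> t dvd w" by (metis insertCI)
  show ?case
  proof (cases "g dvd w")
    case False
    then show ?thesis using w by auto
  next
    case True
    obtain v where v: "v \<in> A" "\<not> g dvd v" using insert.prems(2) by blast
    \<comment> \<open>Exponents start at one: \<open>A\<close> need not contain \<open>1\<close>,
      and \<open>g\<close> has to divide the power.\<close>
    have pow: "w ^ Suc j \<in> A" for j by (induction j) (use w mult in auto)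
    have "\<exists>j. \<forall>t\<in>T. \<not> t dvd w ^ Suc j + v"
    proof (rule ccontr)
      assume "\<nexists>j. \<forall>t\<in>T. \<not> t dvd w ^ Suc j + v"
      then obtain t where t: "\<And>j. t j \<in> T" "\<And>j. t j dvd w ^ Suc j + v" by metis
      have "\<not> inj t"
        using \<open>finite T\<close> t(1) by (metis finite_subset finite_imageD image_subsetI infinite_UNIV_nat)
      then obtain i j where ij: "i < j" "t i = t j" unfolding inj_def by (metis linorder_neqE_nat)
      have "t i dvd (w ^ Suc i + v) - (w ^ Suc j + v)" using t(2) ij by (metis dvd_diff)
      also have "(w ^ Suc i + v) - (w ^ Suc j + v) = w ^ Suc i * (1 - w ^ Suc (j - i - 1))"
      proof -
        have "w ^ Suc j = w ^ Suc i * w ^ Suc (j - i - 1)"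
          unfolding power_add[symmetric] using ij(1) by simp
        then show ?thesis by (simp only: right_diff_distrib) simp
      qed
      finally have "t i dvd w ^ Suc i \<or> t i dvd 1 - w ^ Suc (j - i - 1)"
        using insert.prems(1) t(1) by (meson insertCI prime_elem_dvd_mult_iff)
      moreover have "\<not> t i dvd w ^ Suc i"
        using insert.prems(1) t(1) w(2) by (meson insertCI prime_elem_dvd_power)
      moreover have "\<not> t i dvd 1 - w ^ Suc (j - i - 1)"
        using insert.prems(3) t(1) pow by (meson insertCI)
      ultimately show False by blast
    qed
    then obtain j where j: "\<forall>t\<in>T. \<not> t dvd w ^ Suc j + v" by blast
    moreover have "g dvd w ^ Suc j" using True by simp
    then have "\<not> g dvd w ^ Suc j + v" using v(2) by (metis dvd_add_right_iff)
    moreover have "w ^ Suc j + v \<in> A" using add pow v(1) by blast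
    ultimately show ?thesis by (metis insert_iff)
  qed
qed

lemma prime_elem_not_dvd_prod:
  fixes g :: "'r::comm_semiring_1"
  assumes "prime_elem g" "\<And>h. h \<in> T \<Longrightarrow> \<not> g dvd h"
  shows "\<not> g dvd \<Prod>T"
  using assms(2)
  by (induction T rule: infinite_finite_induct)
     (use assms(1) in \<open>auto simp: prime_elem_dvd_mult_iff prime_elem_not_unit\<close>)

lemma prod_primes_dvd:
  fixes u :: "'r::idom"
  assumes "\<And>g. g \<in> T \<Longrightarrow> prime_elem g" "\<And>g h. g \<in> T \<Longrightarrow> h \<in> T \<Longrightarrow> g \<noteq> h \<Longrightarrow> \<not> g dvd h"
    and "\<And>g. g \<in> T \<Longrightarrow> g dvd u"
  shows "\<Prod>T dvd u"
  using assms
proof (induction T rule: infinite_finite_induct)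
  case (insert g T)
  then obtain k where k: "u = \<Prod>T * k" by (metis dvdE insertCI)
  have "g dvd \<Prod>T * k" using insert.prems(3) k by simp
  moreover have "\<not> g dvd \<Prod>T" using insert by (intro prime_elem_not_dvd_prod) auto
  ultimately have "g dvd k" using insert.prems(1) by (metis insertI1 prime_elem_dvd_mult_iff)
  then show ?case using insert.hyps by (auto simp: k mult.commute[of g] intro: mult_dvd_mono)
qed auto

text \<open>A factor of a form is a form; in degree 0 it would be a nonzero constant, hence a
  unit.\<close>

lemma irreducible_form:
  fixes g :: "'a::field poly poly"
  assumes "irreducible g" "g dvd f" "f \<in> forms n" "f \<noteq> 0"
  obtains e where "e \<ge> 1" "g \<in> forms e"
proof -
  obtain h where "f = g * h" using assms(2) by (elim dvdE)
  then obtain e where e: "g \<in> forms e" using form_factor assms(3,4) by metis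
  have "e \<noteq> 0"
  proof
    assume "e = 0"
    define c where "c = coeff (coeff g 0) 0"
    have g: "g = const c"
    proof (rule poly_eqI, rule poly_eqI)
      show "coeff (coeff g j) i = coeff (coeff (const c) j) i" for i j
        using formsD[OF e, of i j] \<open>e = 0\<close> by (auto simp: c_def coeff_pCons split: nat.split)
    qed
    have "c \<noteq> 0" using assms(1) g by auto
    then have "g * const (inverse c) = 1" by (simp add: g one_pCons)
    then show False using assms(1) by (metis dvd_triv_left irreducible_not_unit)
  qed
  then show ?thesis using that[of e] e by simp
qed

text \<open>A common divisor of \<open>x\<close> and \<open>y\<close> is a unit: dividing
  \<open>x\<close> makes it free of \<open>y\<close>, and dividing \<open>y\<close> then makes it
  invertible.\<close>

lemma exists_zero_const_term_not_dvd:
  fixes g :: "'a::field poly poly"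
  assumes "\<not> is_unit g"
  shows "\<exists>u. zero_const_term u \<and> \<not> g dvd u"
proof (rule ccontr)
  assume "\<not> ?thesis"
  then have *: "g dvd u" if "zero_const_term u" for u using that by blast
  have "g dvd [:[:0, 1:]:]" by (rule *) simp
  then have "degree g \<le> 0" by (metis degree_pCons_0 dvd_imp_degree_le pCons_eq_0_iff zero_neq_one)
  then obtain a where a: "g = [:a:]" by (metis degree_eq_zeroE le_zero_eq)
  have "g dvd [:0, 1:]" by (rule *) simp
  then obtain k where "[:0, 1:] = g * k" by (elim dvdE)
  then have "coeff [:0, 1:] 1 = coeff (Polynomial.smult a k) 1" by (simp add: a)
  then have "[:a:] * [:coeff k 1:] = 1" by (simp add: one_pCons)
  then show False using assms unfolding a by (metis dvd_triv_left)
qed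

text \<open>Some factors of \<open>f\<close> may divide all of \<open>A\<close>, and then no element
  of \<open>A\<close> avoids them. The factors are therefore divided into these and the rest,
  \<open>S1\<close>.\<close>

lemma separating_cofinite_ideal_of_subring:
  fixes S :: "'a::{field_gcd, finite} poly poly set"
  assumes S: "finite S" "\<And>g. g \<in> S \<Longrightarrow> irreducible g"
      "pairwise (\<lambda>g h. \<not> (g dvd h \<and> h dvd g)) S"
    and f: "f = \<Prod>S" "f \<in> forms n" "f \<noteq> 0" "zero_const_term f"
    and A: "0 \<in> A" "\<And>u v. u \<in> A \<Longrightarrow> v \<in> A \<Longrightarrow> u + v \<in> A" "\<And>a u. u \<in> A \<Longrightarrow> const a * u \<in> A"
      "\<And>u v. u \<in> A \<Longrightarrow> v \<in> A \<Longrightarrow> u * v \<in> A" "range ((*) f) \<subseteq> A"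
      "\<And>u. u \<in> A \<Longrightarrow> zero_const_term u"
    and c: "c \<notin> A" "zero_const_term c"
  shows "\<exists>J. cofinite_ideal J \<and> range ((*) f) \<subseteq> J \<and> (\<forall>u\<in>J. zero_const_term u) \<and>
    (\<forall>a\<in>A. c - a \<notin> J)"
proof -
  have prime: "prime_elem g" if "g \<in> S" for g using S(2)[OF that] by (rule irreducible_imp_prime_elem)
  have g_dvd_f: "g dvd f" if "g \<in> S" for g 
    using dvd_prodI[of S g "\<lambda>x. x"] that S(1) f(1) by simp
  have not_dvd: "\<not> g dvd h" if "g \<in> S" "h \<in> S" "g \<noteq> h" for g h
    using that S(2)[of h] S(2)[of g] S(3) irreducibleD'[of h g] irreducible_not_unit
    unfolding pairwise_def by blast
  have g0: "zero_const_term g" if g: "g \<in> S" for g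
    using irreducible_form[OF S(2)[OF g] g_dvd_f[OF g] f(2,3)] formsD[of g _ 0 0]
    by (metis add_0 not_one_le_zero)
  \<comment> \<open>The constant term of \<open>1 - u\<close> is \<open>1\<close>, that of a
    multiple of \<open>g\<close> is \<open>0\<close>.\<close>
  have not_one: "\<not> g dvd 1 - u" if "g \<in> S" "zero_const_term u" for g u
  proof
    assume "g dvd 1 - u"
    then obtain k where "1 - u = g * k" by (elim dvdE)
    then have "coeff (coeff (1 - u) 0) 0 = coeff (coeff (g * k) 0) 0" by simp
    then show False using that g0 by (simp add: coeff_mult_0)
  qed
  \<comment> \<open>Once \<open>w\<close> avoids all factors of \<open>f\<close>, separation holds
    for all modules over \<open>w\<close>; each case below only has to supply \<open>w\<close> and
    \<open>U\<close>.\<close>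
  have closed: "\<exists>J. cofinite_ideal J \<and> range ((*) f) \<subseteq> J \<and> (\<forall>u\<in>J. zero_const_term u) \<and>
      (\<forall>a\<in>U. b - a \<notin> J)"
    if w: "zero_const_term w" "\<And>g. g \<in> S \<Longrightarrow> \<not> g dvd w"
      and U: "submodule_over w U" "range ((*) f) \<subseteq> U" "b \<notin> U" for w U b
  proof (rule separating_cofinite_ideal[OF _ w(1) f(4) U])
    show "finitely_generated_mod w f" unfolding f(1)
    proof (rule finitely_generated_mod_prod)
      fix g assume g: "g \<in> S"
      obtain e where "e \<ge> 1" "g \<in> forms e"
        using irreducible_form[OF S(2)[OF g] g_dvd_f[OF g] f(2,3)] .
      then show "finitely_generated_mod w g"
        using finitely_generated_mod_prime_form prime[OF g] w g by blast
    qed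
  qed
  define S1 where "S1 = {g \<in> S. \<exists>a\<in>A. \<not> g dvd a}"
  define P where "P = \<Prod>S1"
  define Q where "Q = \<Prod>(S - S1)"
  have "S1 \<subseteq> S" by (auto simp: S1_def)
  have A_Q: "Q dvd a" if "a \<in> A" for a
    unfolding Q_def using that prime not_dvd by (intro prod_primes_dvd) (auto simp: S1_def)
  show ?thesis
  proof (cases "\<exists>a\<in>A. \<exists>b. c = a + P * b")
    case True
    then obtain a b where ab: "a \<in> A" "c = a + P * b" by auto
    \<comment> \<open>Here \<open>w\<close> may be any suitable element without constant term, not
      only one from \<open>A\<close>, since the multiples of \<open>Q\<close> form an ideal.\<close>
    have "\<exists>u. zero_const_term u \<and> \<not> g dvd u" if "g \<in> S" for g
      using exists_zero_const_term_not_dvd[OF irreducible_not_unit[OF S(2)[OF that]]] .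
    then have "\<exists>w\<in>{u. zero_const_term u}. \<forall>g\<in>S. \<not> g dvd w"
      using S(1) prime not_one
      by (intro exists_element_avoiding_primes) (auto simp: coeff_mult_0 intro: exI[of _ 0])
    then obtain w where w: "zero_const_term w" "\<And>g. g \<in> S \<Longrightarrow> \<not> g dvd w" by auto
    \<comment> \<open>Otherwise every factor of \<open>f\<close> would divide \<open>P * b\<close>,
      those in \<open>S1\<close> through \<open>P\<close> and the others through \<open>Q\<close>;
      then so would \<open>f\<close>, and \<open>c \<in> A\<close>.\<close>
    have "\<not> Q dvd P * b"
    proof
      assume Q: "Q dvd P * b"
      have "f dvd P * b" unfolding f(1)
      proof (rule prod_primes_dvd)
        fix g assume "g \<in> S"
        then show "g dvd P * b"
          using Q[unfolded P_def Q_def] S(1) \<open>S1 \<subseteq> S\<close> \<open>g \<in> S\<close>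
            dvd_prodI[of S1 g "\<lambda>x. x"] dvd_prodI[of "S - S1" g "\<lambda>x. x"] finite_subset[of S1 S]
          unfolding P_def by (cases "g \<in> S1") (auto dest: dvd_trans)
      qed (use prime not_dvd in auto)
      then have "P * b \<in> A" using A(5) by (auto elim!: dvdE)
      then show False using c(1) ab A(2) by auto
    qed
    moreover have "submodule_over w {u. Q dvd u}"
      by (rule submodule_overI) (auto simp del: mult_pCons_left)
    moreover have "range ((*) f) \<subseteq> {u. Q dvd u}" using A_Q A(5) by auto
    ultimately obtain J where J: "cofinite_ideal J" "range ((*) f) \<subseteq> J"
      "\<forall>u\<in>J. zero_const_term u" "\<forall>q\<in>{u. Q dvd u}. P * b - q \<notin> J"
      using closed[OF w, of "{u. Q dvd u}" "P * b"] by auto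
    have "c - a' \<notin> J" if "a' \<in> A" for a'
    proof -
      have "Q dvd a' - a" using A_Q ab(1) that by (metis dvd_diff)
      then have "P * b - (a' - a) \<notin> J" using J(4) by blast
      then show ?thesis by (simp add: ab(2) algebra_simps)
    qed
    then show ?thesis using J by blast
  next
    case False
    \<comment> \<open>A nonempty product gives \<open>P\<close>, and with it \<open>w + P\<close>,
      zero constant term.\<close>
    have "S1 \<noteq> {}"
    proof
      assume "S1 = {}"
      then have "c = 0 + P * c" by (simp add: P_def)
      then show False using False A(1) by blast
    qed
    then obtain g where "g \<in> S1" by auto
    then have "P = g * \<Prod>(S1 - {g})" unfolding P_def
      using S(1) \<open>S1 \<subseteq> S\<close> by (metis finite_subset prod.remove)
    then have P0: "zero_const_term P"
      using g0 \<open>g \<in> S1\<close> \<open>S1 \<subseteq> S\<close> by (auto simp: coeff_mult_0)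
    have "\<exists>w\<in>A. \<forall>g\<in>S1. \<not> g dvd w"
    proof (rule exists_element_avoiding_primes)
      show "finite S1" using S(1) \<open>S1 \<subseteq> S\<close> by (rule finite_subset[rotated])
    qed (use A prime not_one \<open>S1 \<subseteq> S\<close> in \<open>auto simp: S1_def\<close>)
    then obtain w where w: "w \<in> A" "\<And>g. g \<in> S1 \<Longrightarrow> \<not> g dvd w" by auto
    \<comment> \<open>Adding the multiples of \<open>P\<close> yields closure under
      \<open>w + P\<close>, which \<open>A\<close> itself need not have.\<close>
    define U where "U = {a + P * b | a b. a \<in> A}"
    have U: "u + v \<in> U" "const k * u \<in> U" "w * u \<in> U" "P * u' \<in> U" if "u \<in> U" "v \<in> U" for u v k u'
    proof -
      from that obtain a b a' b' where *: "u = a + P * b" "v = a' + P * b'" "a \<in> A" "a' \<in> A"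
        unfolding U_def by auto
      have "u + v = (a + a') + P * (b + b')" "const k * u = const k * a + P * (const k * b)"
        "w * u = w * a + P * (w * b)" "P * u' = 0 + P * u'"
        unfolding * by (simp_all only: ring_distribs ac_simps add_0)
      moreover have "a + a' \<in> A" "const k * a \<in> A" "w * a \<in> A" "0 \<in> A"
        using A w(1) * by blast+
      ultimately show "u + v \<in> U" "const k * u \<in> U" "w * u \<in> U" "P * u' \<in> U"
        unfolding U_def by blast+
    qed
    have A_U: "a \<in> U" if "a \<in> A" for a
    proof -
      have "a = a + P * 0" by simp
      then show ?thesis using that unfolding U_def by blast
    qed
    have sub: "submodule_over (w + P) U"
    proof (rule submodule_overI)
      show "0 \<in> U" using A(1) A_U by blast
      fix u assume u: "u \<in> U"
      show "(w + P) * u \<in> U"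
        unfolding distrib_right using u by (intro U(1) U(3) U(4))
    qed (use U in blast)+
    \<comment> \<open>Each \<open>g\<close> divides exactly one of the two summands:
      \<open>P\<close> if it is in \<open>S1\<close>, and otherwise \<open>w\<close>, as it divides
      all of \<open>A\<close>.\<close>
    have "\<not> g dvd w + P" if g: "g \<in> S" for g
    proof (cases "g \<in> S1")
      case True
      then have "g dvd P" unfolding P_def
        using S(1) \<open>S1 \<subseteq> S\<close> dvd_prodI[of S1 g "\<lambda>x. x"] finite_subset[of S1 S] by simp
      then show ?thesis using w(2)[OF True] by (metis dvd_add_left_iff)
    next
      case False
      then have "g dvd w" using w(1) g by (auto simp: S1_def)
      moreover have "\<not> g dvd P"
        unfolding P_def using False \<open>S1 \<subseteq> S\<close> g
        by (intro prime_elem_not_dvd_prod prime not_dvd) auto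
      ultimately show ?thesis by (metis dvd_add_right_iff)
    qed
    moreover have "zero_const_term (w + P)" using P0 A(6)[OF w(1)] by simp
    moreover have "range ((*) f) \<subseteq> U" using A(5) A_U by blast
    moreover have "c \<notin> U" using False unfolding U_def by blast
    ultimately obtain J where "cofinite_ideal J" "range ((*) f) \<subseteq> J"
      "\<forall>u\<in>J. zero_const_term u" "\<forall>a\<in>U. c - a \<notin> J"
      using closed[of "w + P" U c] sub by auto
    then show ?thesis using A_U by blast
  qed
qed

subsection \<open>The ring as a quotient and its finite images\<close>

definition residue_class :: "'r::comm_ring_1 \<Rightarrow> 'r \<Rightarrow> 'r set" where
  "residue_class f u = {v. f dvd v - u}"

lemma residue_class_eq_iff: "residue_class f u = residue_class f v \<longleftrightarrow> f dvd u - v"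
proof
  assume "residue_class f u = residue_class f v"
  moreover have "u \<in> residue_class f u" by (simp add: residue_class_def)
  ultimately show "f dvd u - v" by (auto simp: residue_class_def)
next
  assume *: "f dvd u - v"
  have "f dvd w - u \<longleftrightarrow> f dvd w - v" for w
    using dvd_add_left_iff[OF *, of "w - u"] by simp
  then show "residue_class f u = residue_class f v" by (simp add: residue_class_def)
qed

lemma a_r_coset_zero_const_poly_ring:
  "range ((*) f) +>\<^bsub>zero_const_poly_ring\<^esub> u = residue_class f u"
  by (auto simp: a_r_coset_def' zero_const_poly_ring_def residue_class_def dvd_def)
     (metis diff_add_cancel)

lemma carrier_two_generated_ring:
  "carrier (two_generated_ring f) = residue_class f ` {u. zero_const_term u}"
  by (auto simp: two_generated_ring_def FactRing_def A_RCOSETS_def' a_r_coset_zero_const_poly_ring)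
     (auto simp: zero_const_poly_ring_def)

lemma residue_class_mult:
  fixes f :: "'a::comm_ring_1 poly poly"
  shows "residue_class f u \<otimes>\<^bsub>two_generated_ring f\<^esub> residue_class f v = residue_class f (u * v)"
proof -
  have "f dvd z - u * v" if "f dvd a - u" "f dvd b - v" "f dvd z - a * b" for a b z
  proof -
    have "z - u * v = (z - a * b) + (a - u) * b + u * (b - v)" by (simp add: algebra_simps)
    then show ?thesis using that by (metis dvd_add dvd_mult dvd_mult2)
  qed
  moreover have "monoid.mult (zero_const_poly_ring :: 'a poly poly ring) = (*)" by (simp add: zero_const_poly_ring_def)
  ultimately show ?thesis
    unfolding two_generated_ring_def FactRing_def rcoset_mult_def monoid.simps
      a_r_coset_zero_const_poly_ring
    by (auto simp: residue_class_def intro: bexI) (metis diff_self dvd_0_right)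
qed

lemma residue_class_add:
  fixes f :: "'a::comm_ring_1 poly poly"
  shows "residue_class f u \<oplus>\<^bsub>two_generated_ring f\<^esub> residue_class f v = residue_class f (u + v)"
proof -
  have 1: "f dvd (a + b) - (u + v)" if "f dvd a - u" "f dvd b - v" for a b
    using dvd_add[OF that] by (simp add: algebra_simps)
  have 2: "\<exists>a. f dvd a - u \<and> (\<exists>b. f dvd b - v \<and> z = a + b)" if "f dvd z - (u + v)" for z
    using that by (intro exI[of _ "z - v"] conjI exI[of _ v]) (auto simp: algebra_simps)
  show ?thesis
    unfolding two_generated_ring_def FactRing_def ring_record_simps set_add_def' residue_class_def
    using 1 2 by (auto simp: zero_const_poly_ring_def)
qed

lemma zero_two_generated_ring: "\<zero>\<^bsub>two_generated_ring f\<^esub> = residue_class f 0"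
  by (auto simp: two_generated_ring_def FactRing_def residue_class_def)

lemma a_inv_residue_class:
  assumes "zero_const_term f" "zero_const_term u"
  shows "\<ominus>\<^bsub>two_generated_ring f\<^esub> residue_class f u = residue_class f (- u)"
proof -
  interpret nonunital_ring "two_generated_ring f"
    using nonunital_ring_two_generated_ring[OF assms(1)] .
  show ?thesis
    by (rule minus_equality)
      (use assms in \<open>auto simp: residue_class_add zero_two_generated_ring carrier_two_generated_ring\<close>)
qed

text \<open>The finite residue ring modulo \<open>J\<close>, with residue classes coded as indices into a list of
  representatives.\<close>

lemma finite_quotient_ring:
  fixes f :: "'a::comm_ring_1 poly poly"
  assumes f: "zero_const_term f" and J: "cofinite_ideal J" "range ((*) f) \<subseteq> J"
    "\<forall>u\<in>J. zero_const_term u"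
  obtains F :: "nat ring" and \<phi> where "nonunital_ring F" "finite (carrier F)"
    "\<phi> \<in> nonunital_ring_hom (two_generated_ring f) F"
    "\<And>u v. \<phi> (residue_class f u) = \<phi> (residue_class f v) \<longleftrightarrow> u - v \<in> J"
proof -
  have J_add: "u + v \<in> J" if "u \<in> J" "v \<in> J" for u v
    using that J(1) unfolding cofinite_ideal_def by blast
  have J_mult: "r * u \<in> J" if "u \<in> J" for u r
    using that J(1) unfolding cofinite_ideal_def by blast
  have J_uminus: "- u \<in> J" if "u \<in> J" for u using J_mult[OF that, of "- 1"] by simp
  have J_diff: "u - v \<in> J" if "u \<in> J" "v \<in> J" for u v
    using J_add[OF that(1) J_uminus[OF that(2)]] by simp
  have J_0: "0 \<in> J" using J(1) unfolding cofinite_ideal_def by blast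
  obtain zs where zs: "\<And>u. \<exists>z\<in>set zs. u - z \<in> J"
    using J(1) finite_list unfolding cofinite_ideal_def by metis
  \<comment> \<open>Taking the least index makes the code depend on the residue class alone.\<close>
  define code where "code u = (LEAST k. k < length zs \<and> u - zs ! k \<in> J)" for u
  have code: "code u < length zs \<and> u - zs ! code u \<in> J" for u
    unfolding code_def by (rule LeastI_ex) (metis zs in_set_conv_nth)
  have code_eq_iff: "code u = code v \<longleftrightarrow> u - v \<in> J" for u v
  proof
    assume "code u = code v"
    then have "(u - zs ! code u) - (v - zs ! code u) \<in> J" using code by (metis J_diff)
    then show "u - v \<in> J" by simp
  next
    assume uv: "u - v \<in> J"
    have "u - z \<in> J \<longleftrightarrow> v - z \<in> J" for z
      using J_diff[OF _ uv, of "u - z"] J_add[OF _ uv, of "v - z"] by auto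
    then show "code u = code v" unfolding code_def by simp
  qed
  define F :: "nat ring" where
    "F = \<lparr>carrier = code ` {u. zero_const_term u}, monoid.mult = (\<lambda>k l. code (zs ! k * zs ! l)),
      one = 0, zero = code 0, add = (\<lambda>k l. code (zs ! k + zs ! l))\<rparr>"
  have carrier_F: "carrier F = code ` {u. zero_const_term u}" by (simp add: F_def)
  have mult_F: "code u \<otimes>\<^bsub>F\<^esub> code v = code (u * v)" for u v
  proof -
    have "zs ! code u * zs ! code v - u * v
        = - (zs ! code v * (u - zs ! code u)) - u * (v - zs ! code v)"
      by (simp add: algebra_simps)
    also have "\<dots> \<in> J" by (rule J_diff[OF J_uminus[OF J_mult] J_mult]) (use code in auto)
    finally show ?thesis by (simp add: F_def code_eq_iff)
  qed
  have add_F: "code u \<oplus>\<^bsub>F\<^esub> code v = code (u + v)" for u v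
  proof -
    have "zs ! code u + zs ! code v - (u + v) = - ((u - zs ! code u) + (v - zs ! code v))"
      by (simp add: algebra_simps)
    also have "\<dots> \<in> J" by (rule J_uminus[OF J_add]) (use code in auto)
    finally show ?thesis by (simp add: F_def code_eq_iff)
  qed
  have zero_F: "\<zero>\<^bsub>F\<^esub> = code 0" by (simp add: F_def)
  note F_simps = carrier_F mult_F add_F zero_F
  have "abelian_group F"
  proof (rule abelian_groupI)
    fix x assume "x \<in> carrier F"
    then obtain u where "x = code u" "zero_const_term u" by (auto simp: F_simps)
    then show "\<exists>y\<in>carrier F. y \<oplus>\<^bsub>F\<^esub> x = \<zero>\<^bsub>F\<^esub>"
      by (intro bexI[of _ "code (- u)"]) (auto simp: F_simps)
  qed (auto simp: F_simps ac_simps intro!: imageI)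
  then have "nonunital_ring F"
    by (intro nonunital_ring.intro nonunital_ring_axioms.intro)
       (auto simp: F_simps coeff_mult_0 algebra_simps intro!: imageI)
  moreover have "finite (carrier F)"
  proof (rule finite_subset)
    have "code u < length zs" for u using code by blast
    then show "carrier F \<subseteq> {..<length zs}" by (auto simp only: carrier_F lessThan_iff)
  qed simp
  \<comment> \<open>The choice of representative is harmless: two of them differ by a multiple of
    \<open>f\<close>, which lies in \<open>J\<close>.\<close>
  moreover define \<phi> where "\<phi> X = code (SOME u. u \<in> X)" for X
  have \<phi>: "\<phi> (residue_class f u) = code u" for u
  proof -
    have "u \<in> residue_class f u" by (simp add: residue_class_def)
    then have "(SOME v. v \<in> residue_class f u) \<in> residue_class f u" by (rule someI)
    then have "(SOME v. v \<in> residue_class f u) - u \<in> J"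
      using J(2) by (auto simp: residue_class_def elim!: dvdE)
    then show ?thesis by (simp add: \<phi>_def code_eq_iff)
  qed
  have "\<phi> \<in> nonunital_ring_hom (two_generated_ring f) F"
    unfolding nonunital_ring_hom_def hom_def
    by (auto simp: carrier_two_generated_ring residue_class_mult residue_class_add \<phi> F_simps)
  ultimately show ?thesis using that[of F \<phi>] \<phi> code_eq_iff by simp
qed

text \<open>Subrings of the quotient are pulled back to sets of polynomials, separated there by an
  ideal \<open>J\<close>, and pushed to the finite ring of residues modulo \<open>J\<close>.\<close>

lemma finitely_separable_two_generated_ringI:
  fixes f :: "'p::prime_card mod_ring poly poly"
  assumes f: "zero_const_term f"
    and sep: "\<And>A c. 0 \<in> A \<Longrightarrow> (\<And>u v. u \<in> A \<Longrightarrow> v \<in> A \<Longrightarrow> u + v \<in> A) \<Longrightarrow>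
      (\<And>a u. u \<in> A \<Longrightarrow> const a * u \<in> A) \<Longrightarrow> (\<And>u v. u \<in> A \<Longrightarrow> v \<in> A \<Longrightarrow> u * v \<in> A) \<Longrightarrow>
      range ((*) f) \<subseteq> A \<Longrightarrow> (\<And>u. u \<in> A \<Longrightarrow> zero_const_term u) \<Longrightarrow> c \<notin> A \<Longrightarrow> zero_const_term c \<Longrightarrow>
      \<exists>J. cofinite_ideal J \<and> range ((*) f) \<subseteq> J \<and> (\<forall>u\<in>J. zero_const_term u) \<and> (\<forall>a\<in>A. c - a \<notin> J)"
  shows "finitely_separable (two_generated_ring f)"
  unfolding finitely_separable_def
proof (intro ballI allI impI; elim conjE)
  fix X B
  assume X: "X \<in> carrier (two_generated_ring f)" "X \<notin> B"
    and B: "nonunital_subring B (two_generated_ring f)"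
  interpret K: nonunital_ring "two_generated_ring f"
    using nonunital_ring_two_generated_ring[OF f] .
  interpret B: additive_subgroup B "two_generated_ring f"
    using B unfolding nonunital_subring_def by blast
  obtain c where c: "X = residue_class f c" "zero_const_term c"
    using X by (auto simp: carrier_two_generated_ring)
  define A where "A = {u. zero_const_term u \<and> residue_class f u \<in> B}"
  have A_0: "0 \<in> A" using B.zero_closed by (simp add: A_def zero_two_generated_ring)
  have A_add: "u + v \<in> A" if "u \<in> A" "v \<in> A" for u v
    using that B.a_closed[of "residue_class f u" "residue_class f v"]
    by (auto simp: A_def residue_class_add)
  have "\<exists>J. cofinite_ideal J \<and> range ((*) f) \<subseteq> J \<and> (\<forall>u\<in>J. zero_const_term u) \<and> (\<forall>a\<in>A. c - a \<notin> J)"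
  proof (rule sep)
    fix a :: "'p mod_ring" and u :: "'p mod_ring poly poly" assume u: "u \<in> A"
    \<comment> \<open>Every residue modulo \<open>p\<close> is a sum of ones, so additive closure
      gives closure under scalars.\<close>
    obtain k where k: "a = of_nat k" using surj_of_nat_mod_ring[of a] by blast
    have "of_nat k * u \<in> A" by (induction k) (auto simp: distrib_right A_0 A_add u)
    then show "const a * u \<in> A" by (simp only: k of_nat_poly)
  next
    fix u v assume "u \<in> A" "v \<in> A"
    then show "u * v \<in> A"
      using B unfolding A_def nonunital_subring_def by (auto simp: coeff_mult_0 residue_class_mult[symmetric])
  next
    have "residue_class f (f * g) = residue_class f 0" for g by (simp add: residue_class_eq_iff)
    then show "range ((*) f) \<subseteq> A" using A_0 f by (auto simp: A_def coeff_mult_0)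
  qed (use A_0 A_add X(2) c in \<open>auto simp: A_def\<close>)
  then obtain J where J: "cofinite_ideal J" "range ((*) f) \<subseteq> J" "\<forall>u\<in>J. zero_const_term u"
    "\<forall>a\<in>A. c - a \<notin> J" by blast
  obtain F :: "nat ring" and \<phi> where F: "nonunital_ring F" "finite (carrier F)"
    "\<phi> \<in> nonunital_ring_hom (two_generated_ring f) F"
    "\<And>u v. \<phi> (residue_class f u) = \<phi> (residue_class f v) \<longleftrightarrow> u - v \<in> J"
    using finite_quotient_ring[OF f J(1-3)] by blast
  have "\<phi> X \<notin> \<phi> ` B"
  proof
    assume "\<phi> X \<in> \<phi> ` B"
    then obtain Y where Y: "Y \<in> B" "\<phi> X = \<phi> Y" by auto
    then obtain u where u: "Y = residue_class f u" "zero_const_term u"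
      using B.a_Hcarr[OF Y(1)] by (auto simp: carrier_two_generated_ring)
    then have "u \<in> A" using Y by (simp add: A_def)
    then show False using Y(2) J(4) by (simp add: c(1) u(1) F(4))
  qed
  then show "\<exists>(F :: nat ring) \<phi>. nonunital_ring F \<and> finite (carrier F) \<and>
      \<phi> \<in> nonunital_ring_hom (two_generated_ring f) F \<and> \<phi> X \<notin> \<phi> ` B"
    using F by blast
qed

subsection \<open>A subring that is dense modulo a non-squarefree polynomial\<close>

text \<open>The value at \<open>0\<close> keeps \<open>c\<close> out of the subring; the growing
  gaps between powers of two exclude periodicity.\<close>

definition lacunary :: "nat \<Rightarrow> 'a::zero_neq_one" where
  "lacunary k = (if k = 0 \<or> (\<exists>m. k = 2 ^ m) then 1 else 0)"

text \<open>With \<open>i + k = 2 ^ j\<close>, the index \<open>j + k\<close> exceeds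
  \<open>2 ^ j\<close> by \<open>j - i < 2 ^ j\<close>, so it falls strictly between two powers of
  two.\<close>

lemma lacunary_not_periodic:
  assumes "i < j"
  obtains k where "k \<ge> 1" "lacunary (i + k) = (1 :: 'a::zero_neq_one)" "lacunary (j + k) = (0 :: 'a)"
proof -
  define k where "k = 2 ^ j - i"
  have j: "j < 2 ^ j" by simp
  then have "i < 2 ^ j" using assms by linarith
  then have k: "k \<ge> 1" "i + k = 2 ^ j" "j + k = 2 ^ j + (j - i)" using assms by (auto simp: k_def)
  have "j + k \<noteq> 2 ^ m" for m
  proof
    assume m: "j + k = 2 ^ m"
    then have "(2::nat) ^ j < 2 ^ m" "(2::nat) ^ m < 2 ^ Suc j" using k(2) j assms m
      unfolding power_Suc by linarith+
    then have "j < m" "m < Suc j" by 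
      (metis power_less_imp_less_exp numeral_One one_less_numeral_iff semiring_norm(76))+
    then show False by simp
  qed
  then show ?thesis using that[of k] k by (auto simp: lacunary_def)
qed

definition lacunary_functional :: "'a::comm_ring_1 poly \<Rightarrow> 'a" where
  "lacunary_functional q = (\<Sum>k\<le>degree q. coeff q k * lacunary k)"

lemma lacunary_functional_eq:
  "degree q \<le> n \<Longrightarrow> lacunary_functional q = (\<Sum>k\<le>n. coeff q k * lacunary k)"
  unfolding lacunary_functional_def by (rule sum.mono_neutral_left) (auto simp: coeff_eq_0)

lemma lacunary_functional_add:
  "lacunary_functional (q + r) = lacunary_functional q + lacunary_functional r"
proof -
  have "degree (q + r) \<le> max (degree q) (degree r)" by (rule degree_add_le_max)
  then show ?thesis
    by (simp add: lacunary_functional_eq[of _ "max (degree q) (degree r)"] sum.distrib algebra_simps)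
qed

lemma lacunary_functional_uminus: "lacunary_functional (- q) = - lacunary_functional q"
  by (simp add: lacunary_functional_def sum_negf)

lemma lacunary_functional_monom: "lacunary_functional (monom 1 k) = lacunary k"
proof -
  have "lacunary_functional (monom 1 k) = (\<Sum>i\<le>k. coeff (monom 1 k) i * lacunary i)"
    by (rule lacunary_functional_eq) (rule degree_monom_le)
  also have "\<dots> = (\<Sum>i\<le>k. if i = k then lacunary k else 0)" by (rule sum.cong) auto
  finally show ?thesis by simp
qed

lemma eval_at_monom: "eval_at w (monom 1 k) = w ^ k"
  by (induction k) (simp_all add: monom_Suc eval_at_pCons flip: one_pCons)

text \<open>If \<open>g\<close> involves \<open>y\<close>, take \<open>t = x\<close>: a nonzero
  polynomial in \<open>x\<close> has degree 0 in \<open>y\<close>. Otherwise take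
  \<open>t = y\<close>: a nonunit \<open>a\<close> in \<open>x\<close> alone would have to divide
  the coefficients of \<open>q\<close>, which are constants.\<close>

lemma exists_transcendental_mod:
  fixes g :: "'a::field poly poly"
  assumes "\<not> is_unit g"
  obtains t where "zero_const_term t" "\<And>q. g dvd eval_at t q \<Longrightarrow> q = 0"
proof (cases "degree g = 0")
  case False
  have eval: "eval_at [:[:0, 1:]:] q = [:q:]" for q :: "'a poly"
    by (induction q) (simp_all add: eval_at_pCons)
  show ?thesis
  proof (rule that)
    show "q = 0" if "g dvd eval_at [:[:0, 1:]:] q" for q
      using False that dvd_imp_degree_le[of g "[:q:]"] by (auto simp: eval)
  qed simp
next
  case True
  then obtain a where a: "g = [:a:]" by (metis degree_eq_zeroE)
  have eval: "coeff (eval_at [:0, 1:] q) k = [:coeff q k:]" for q :: "'a poly" and k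
    by (induction q arbitrary: k) (auto simp: eval_at_pCons coeff_pCons split: nat.splits)
  show ?thesis
  proof (rule that)
    fix q assume "g dvd eval_at [:0, 1:] q"
    then obtain r where "eval_at [:0, 1:] q = [:a:] * r" unfolding a by (elim dvdE)
    then have coeff: "[:coeff q k:] = a * coeff r k" for k
      by (metis coeff_smult eval mult_pCons_left mult_zero_left pCons_0_0 add.right_neutral)
    have "coeff q k = 0" for k
    proof (rule ccontr)
      assume c: "coeff q k \<noteq> 0"
      have "[:a:] * [:coeff r k * [:inverse (coeff q k):]:] = [:[:coeff q k:] * [:inverse (coeff q k):]:]"
        by (simp add: coeff ac_simps)
      also have "\<dots> = 1" using c by (simp add: one_pCons)
      finally show False using assms unfolding a by (metis dvd_triv_left)
    qed
    then show "q = 0" by (simp add: poly_eq_iff)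
  qed simp
qed

text \<open>A squarefree element is a unit times the product of its distinct normalized primes; the
  unit is moved into one of these, which exists because \<open>f\<close> is not a unit.\<close>

lemma prod_distinct_irreducibles_if_squarefree:
  fixes f :: "'r::factorial_ring_gcd"
  assumes f: "f \<noteq> 0" "\<not> is_unit f" and sq: "\<And>g. g * g dvd f \<Longrightarrow> is_unit g"
  shows "\<exists>S. finite S \<and> (\<forall>g\<in>S. irreducible g) \<and>
    pairwise (\<lambda>g h. \<not> (g dvd h \<and> h dvd g)) S \<and> f = \<Prod>S"
proof -
  define T where "T = prime_factors f"
  have fin: "finite T" unfolding T_def by simp
  have T: "prime p" "p dvd f" if "p \<in> T" for p using that by (auto simp: T_def in_prime_factors_iff)
  have mult: "multiplicity p f = 1" if "p \<in> T" for p
  proof -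
    have "multiplicity p f > 0" using that by (auto simp: T_def prime_factors_multiplicity)
    moreover have "\<not> multiplicity p f \<ge> 2"
    proof
      assume "multiplicity p f \<ge> 2"
      then have "p ^ 2 dvd f" by (rule multiplicity_dvd')
      then have "is_unit p" unfolding power2_eq_square by (rule sq)
      then show False using not_prime_unit[of p] T(1)[OF that] by blast
    qed
    ultimately show ?thesis by simp
  qed
  have "prime_factorization f = mset_set T"
  proof (rule multiset_eqI)
    fix p show "count (prime_factorization f) p = count (mset_set T) p"
    proof (cases "p \<in> T")
      case True
      then show ?thesis using mult[OF True] T(1)[OF True] fin by (simp add: count_prime_factorization)
    next
      case False
      then show ?thesis by (simp add: T_def count_eq_zero_iff)
    qed
  qed
  then have "normalize (\<Prod>T) = normalize f"
    using prod_mset_prime_factorization_weak[OF f(1)] by (simp add: prod_unfold_prod_mset)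
  then have dvd: "\<Prod>T dvd f" "f dvd \<Prod>T" by (simp_all add: associated_iff_dvd)
  obtain u where u: "f = u * \<Prod>T" using dvd(1) by (metis dvdE mult.commute)
  have "is_unit u"
  proof -
    have "u * \<Prod>T dvd 1 * \<Prod>T" using dvd(2) by (simp add: u)
    moreover have "\<Prod>T \<noteq> 0" using f(1) u by auto
    ultimately show ?thesis by (metis dvd_mult_cancel_right)
  qed
  have "T \<noteq> {}" using f(2) u \<open>is_unit u\<close> by auto
  then obtain p where p: "p \<in> T" by auto
  define p' where "p' = u * p"
  have dvd_p': "p' dvd q \<longleftrightarrow> p dvd q" "q dvd p' \<longleftrightarrow> q dvd p" for q
    using \<open>is_unit u\<close> unfolding p'_def by (simp_all add: mult_unit_dvd_iff' dvd_mult_unit_iff')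
  have inc: "\<not> q dvd r" if "q \<in> T" "r \<in> T" "q \<noteq> r" for q r
    using primes_dvd_imp_eq[of q r] T(1) that by blast
  \<comment> \<open>Otherwise the product over the set would lose a factor.\<close>
  have "p' \<notin> T - {p}" using inc[of p p'] p dvd_p'(1)[of p'] by auto
  have "\<Prod>T = p * \<Prod>(T - {p})" using fin p by (rule prod.remove)
  then have f_eq: "f = \<Prod>(insert p' (T - {p}))"
    using fin \<open>p' \<notin> T - {p}\<close> by (simp add: u p'_def mult.assoc)
  have irr: "irreducible q" if "q \<in> T" for q
    using T(1)[OF that] by (simp add: prime_elem_imp_irreducible)
  have "irreducible p'"
    using irr[OF p] \<open>is_unit u\<close> unfolding p'_def by (simp add: irreducible_mult_unit_left)
  moreover have "pairwise (\<lambda>g h. \<not> (g dvd h \<and> h dvd g)) (insert p' (T - {p}))"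
    using inc p by (auto simp: pairwise_insert pairwise_def dvd_p')
  ultimately show ?thesis
    using fin irr f_eq by (intro exI[of _ "insert p' (T - {p})"]) auto
qed

lemma not_finitely_separable_if_square_dvd:
  fixes g h :: "'a::field poly poly"
  defines "f \<equiv> g * (g * h)"
  assumes f: "f \<noteq> 0" "zero_const_term f" and g: "\<not> is_unit g"
  shows "\<not> finitely_separable (two_generated_ring f)"
proof
  assume sep: "finitely_separable (two_generated_ring f)"
  let ?K = "two_generated_ring f"
  interpret K: nonunital_ring ?K using nonunital_ring_two_generated_ring[OF f(2)] .
  obtain t where t: "zero_const_term t" "\<And>q. g dvd eval_at t q \<Longrightarrow> q = 0"
    using exists_transcendental_mod[OF g] by blast
  define c where "c = g * h"
  have c: "zero_const_term c" "c \<noteq> 0" using f by (auto simp: c_def f_def coeff_mult_0)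
  have f_c: "f = g * c" by (simp add: f_def c_def)
  define V where "V = {g * r + eval_at t q | r q. lacunary_functional q = 0}"
  have V_0: "0 \<in> V" unfolding V_def
    by (auto intro!: exI[of _ 0] simp: lacunary_functional_def)
  have V_add: "u + v \<in> V" if "u \<in> V" "v \<in> V" for u v
  proof -
    from that obtain r q r' q' where "u = g * r + eval_at t q" "v = g * r' + eval_at t q'"
      "lacunary_functional q = 0" "lacunary_functional q' = 0" unfolding V_def by auto
    then have "u + v = g * (r + r') + eval_at t (q + q')" "lacunary_functional (q + q') = 0"
      by (simp_all add: algebra_simps eval_at_add lacunary_functional_add)
    then show ?thesis unfolding V_def by blast
  qed
  have V_uminus: "- u \<in> V" if "u \<in> V" for u
  proof -
    from that obtain r q where "u = g * r + eval_at t q" "lacunary_functional q = 0"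
      unfolding V_def by auto
    then have "- u = g * (- r) + eval_at t (- q)" "lacunary_functional (- q) = 0"
      by (simp_all add: eval_at_minus lacunary_functional_uminus)
    then show ?thesis unfolding V_def by blast
  qed
  have zero_const_mult: "zero_const_term (c * u)" for u using c(1) by (simp add: coeff_mult_0)
  define A where "A = (\<lambda>v. residue_class f (c * v)) ` V"
  have A_carrier: "A \<subseteq> carrier ?K"
    unfolding A_def carrier_two_generated_ring using zero_const_mult by blast
  have "subgroup A (add_monoid ?K)"
  proof (rule K.a_group[THEN group.subgroupI])
    show "inv\<^bsub>add_monoid ?K\<^esub> X \<in> A" if "X \<in> A" for X
    proof -
      from that obtain v where v: "v \<in> V" "X = residue_class f (c * v)" unfolding A_def by auto
      have "\<ominus>\<^bsub>?K\<^esub> X = residue_class f (c * (- v))"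
        using a_inv_residue_class[OF f(2) zero_const_mult, of v] by (simp add: v)
      then show ?thesis using V_uminus[OF v(1)] unfolding A_def a_inv_def by blast
    qed
    show "X \<otimes>\<^bsub>add_monoid ?K\<^esub> Y \<in> A" if "X \<in> A" "Y \<in> A" for X Y
    proof -
      from that obtain v v' where v: "v \<in> V" "X = residue_class f (c * v)"
        "v' \<in> V" "Y = residue_class f (c * v')" unfolding A_def by auto
      have "X \<oplus>\<^bsub>?K\<^esub> Y = residue_class f (c * (v + v'))"
        by (simp add: v residue_class_add distrib_left)
      then show ?thesis using V_add[OF v(1,3)] unfolding A_def by auto
    qed
  qed (use A_carrier V_0 in \<open>auto simp: A_def\<close>)
  moreover have "X \<otimes>\<^bsub>?K\<^esub> Y \<in> A" if XY: "X \<in> A" "Y \<in> A" for X Y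
  proof -
    from XY obtain v v' where v: "X = residue_class f (c * v)" "Y = residue_class f (c * v')"
      unfolding A_def by auto
    \<comment> \<open>\<open>c * c = f * h\<close>, so all products in \<open>A\<close>
      vanish.\<close>
    have "f dvd c * v * (c * v') - c * 0"
      unfolding f_c by (simp add: c_def ac_simps)
    then have "X \<otimes>\<^bsub>?K\<^esub> Y = residue_class f (c * 0)"
      unfolding v residue_class_mult residue_class_eq_iff .
    then show ?thesis using V_0 unfolding A_def by blast
  qed
  ultimately have "nonunital_subring A ?K"
    unfolding nonunital_subring_def by (blast intro: additive_subgroup.intro)
  moreover have "residue_class f c \<notin> A"
  proof
    assume "residue_class f c \<in> A"
    then obtain r q where q: "lacunary_functional q = 0"
      and "residue_class f c = residue_class f (c * (g * r + eval_at t q))"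
      unfolding A_def V_def by blast
    then have "g * c dvd c - c * (g * r + eval_at t q)" unfolding residue_class_eq_iff f_c by simp
    also have "c - c * (g * r + eval_at t q) = (1 - (g * r + eval_at t q)) * c"
      by (simp add: algebra_simps)
    \<comment> \<open>Cancelling \<open>c\<close> leads to \<open>g dvd eval_at t (1 - q)\<close>,
      so \<open>q = 1\<close>, where the functional takes the value \<open>1\<close>.\<close>
    finally have "g dvd 1 - (g * r + eval_at t q)" using c(2) by simp
    then have "g dvd 1 - (g * r + eval_at t q) + g * r" by (rule dvd_add) simp
    also have "1 - (g * r + eval_at t q) + g * r = eval_at t (1 - q)"
      by (simp add: eval_at_diff)
    finally have "g dvd eval_at t (1 - q)" .
    then have "q = monom 1 0" using t(2)[of "1 - q"] by simp
    then have "lacunary_functional q = lacunary 0" by (simp only: lacunary_functional_monom)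
    then show False using q by (simp add: lacunary_def)
  qed
  moreover have "residue_class f c \<in> carrier ?K"
    using c(1) by (simp add: carrier_two_generated_ring)
  ultimately obtain F :: "nat ring" and \<phi> where F: "nonunital_ring F" "finite (carrier F)"
    and \<phi>: "\<phi> \<in> nonunital_ring_hom ?K F" "\<phi> (residue_class f c) \<notin> \<phi> ` A"
    using sep unfolding finitely_separable_def by blast
  interpret F: nonunital_ring F by (rule F(1))
  define \<psi> where "\<psi> u = \<phi> (residue_class f u)" for u
  have \<psi>_carrier: "\<psi> u \<in> carrier F" if "zero_const_term u" for u
    using \<phi>(1) that unfolding nonunital_ring_hom_def hom_def \<psi>_def
    by (auto simp: carrier_two_generated_ring)
  have \<psi>_mult: "\<psi> (u * v) = \<psi> u \<otimes>\<^bsub>F\<^esub> \<psi> v" if "zero_const_term u" "zero_const_term v" for u v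
    using \<phi>(1) that unfolding nonunital_ring_hom_def hom_def \<psi>_def
    by (auto simp: carrier_two_generated_ring simp flip: residue_class_mult)
  have \<psi>_add: "\<psi> (u + v) = \<psi> u \<oplus>\<^bsub>F\<^esub> \<psi> v" if "zero_const_term u" "zero_const_term v" for u v
    using \<phi>(1) that unfolding nonunital_ring_hom_def hom_def \<psi>_def
    by (auto simp: carrier_two_generated_ring simp flip: residue_class_add)
  have "\<not> inj (\<lambda>i. \<psi> (c * t ^ i))"
  proof
    assume "inj (\<lambda>i. \<psi> (c * t ^ i))"
    moreover have "range (\<lambda>i. \<psi> (c * t ^ i)) \<subseteq> carrier F"
      using \<psi>_carrier zero_const_mult by blast
    ultimately show False using F(2) by (meson finite_imageD finite_subset infinite_UNIV_nat)
  qed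
  then obtain i j where ij: "i < j" "\<psi> (c * t ^ i) = \<psi> (c * t ^ j)"
    unfolding inj_def by (metis linorder_neqE_nat)
  obtain k where k: "k \<ge> 1" "lacunary (i + k) = (1::'a)" "lacunary (j + k) = (0::'a)"
    using lacunary_not_periodic[OF ij(1)] by blast
  \<comment> \<open>\<open>\<psi>\<close> is multiplicative on polynomials without constant term;
    \<open>k \<ge> 1\<close> brings \<open>t ^ k\<close> among them.\<close>
  have t0: "zero_const_term (t ^ k)" using t(1) k(1) by (cases k) (auto simp: coeff_mult_0)
  have shift: "\<psi> (c * t ^ (l + k)) = \<psi> (c * t ^ l) \<otimes>\<^bsub>F\<^esub> \<psi> (t ^ k)" for l
    using \<psi>_mult[OF zero_const_mult t0, of "t ^ l"] by (simp add: power_add mult.assoc)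
  \<comment> \<open>The functional takes the value \<open>1 + 0 - 1 = 0\<close> at \<open>q\<close>,
    while in \<open>F\<close> the terms with \<open>t ^ (i + k)\<close> and
    \<open>t ^ (j + k)\<close> cancel and leave the image of \<open>c\<close>.\<close>
  define q where "q = monom 1 0 + monom 1 (j + k) + - monom (1::'a) (i + k)"
  define v where "v = 1 + t ^ (j + k) - t ^ (i + k)"
  have "lacunary_functional q = 0"
    unfolding q_def lacunary_functional_add lacunary_functional_uminus lacunary_functional_monom
    using k by (simp add: lacunary_def[of 0])
  moreover have "v = g * 0 + eval_at t q"
    unfolding q_def eval_at_add eval_at_minus eval_at_monom by (simp add: v_def)
  ultimately have "v \<in> V" unfolding V_def by blast
  then have "\<psi> (c * v) \<in> \<phi> ` A" unfolding \<psi>_def A_def by blast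
  moreover have "\<psi> (c * v) = \<psi> c"
  proof -
    have "\<psi> (c * v) \<oplus>\<^bsub>F\<^esub> \<psi> (c * t ^ (i + k)) = \<psi> (c * v + c * t ^ (i + k))"
      using \<psi>_add[OF zero_const_mult zero_const_mult] by simp
    also have "c * v + c * t ^ (i + k) = c + c * t ^ (j + k)"
      by (simp add: v_def algebra_simps)
    also have "\<psi> (c + c * t ^ (j + k)) = \<psi> c \<oplus>\<^bsub>F\<^esub> \<psi> (c * t ^ (j + k))"
      using \<psi>_add[OF c(1) zero_const_mult] by simp
    also have "\<psi> (c * t ^ (j + k)) = \<psi> (c * t ^ (i + k))" by (simp only: shift ij(2))
    finally show ?thesis
      using F.add.right_cancel \<psi>_carrier[OF zero_const_mult] \<psi>_carrier[OF c(1)] by blast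
  qed
  ultimately show False using \<phi>(2) by (simp add: \<psi>_def)
qed

section \<open>The criterion for forms of positive degree\<close>

theorem mainTheorem3:
  fixes f :: "'p::prime_card mod_ring poly poly" and n :: nat
  assumes "n \<ge> 1" and "homogeneous_of_degree n f"
  shows "finitely_separable (two_generated_ring f) \<longleftrightarrow> separable_poly f"
proof -
  have f: "f \<noteq> 0" "f \<in> forms n"
    using assms(2) by (auto simp: homogeneous_of_degree_def forms_def)
  have f0: "zero_const_term f" using formsD[OF f(2), of 0 0] assms(1) by simp
  show ?thesis
  proof
    assume sep: "finitely_separable (two_generated_ring f)"
    have "is_unit g" if sq: "g * g dvd f" for g
    proof (rule ccontr)
      assume g: "\<not> is_unit g"
      obtain h where h: "f = g * (g * h)" using sq unfolding dvd_def by (auto simp: mult.assoc)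
      show False using not_finitely_separable_if_square_dvd[of g h] sep f(1) f0 g h by simp
    qed
    moreover have "\<not> is_unit f"
    proof
      assume "is_unit f"
      then obtain k where "1 = f * k" by (elim dvdE)
      then have "coeff (coeff 1 0) 0 = coeff (coeff (f * k) 0) 0" by metis
      then show False using f0 by (simp add: coeff_mult_0)
    qed
    ultimately show "separable_poly f"
      unfolding separable_poly_def using f(1) by (intro prod_distinct_irreducibles_if_squarefree)
  next
    assume "separable_poly f"
    then obtain S where S: "finite S \<and> (\<forall>g\<in>S. irreducible g) \<and>
        pairwise (\<lambda>g h. \<not> (g dvd h \<and> h dvd g)) S \<and> f = \<Prod>S"
      unfolding separable_poly_def ..
    show "finitely_separable (two_generated_ring f)"
    proof (rule finitely_separable_two_generated_ringI[OF f0])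
      fix A c
      assume A: "0 \<in> A" "\<And>u v. u \<in> A \<Longrightarrow> v \<in> A \<Longrightarrow> u + v \<in> A" "\<And>a u. u \<in> A \<Longrightarrow> const a * u \<in> A"
        "\<And>u v. u \<in> A \<Longrightarrow> v \<in> A \<Longrightarrow> u * v \<in> A" "range ((*) f) \<subseteq> A"
        "\<And>u. u \<in> A \<Longrightarrow> zero_const_term u"
        and c: "c \<notin> A" "zero_const_term c"
      show "\<exists>J. cofinite_ideal J \<and> range ((*) f) \<subseteq> J \<and> (\<forall>u\<in>J. zero_const_term u) \<and>
          (\<forall>a\<in>A. c - a \<notin> J)"
        by (rule separating_cofinite_ideal_of_subring[OF _ _ _ _ f(2,1) f0 A c]) (use S in auto)
    qed
  qed
qed

end
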